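(* Let $X,Y$ be bounded degree simplicial complexes, where $X$ has dimension $d$ and $Y$ is uniformly $k$-connected for all $1\le k\leq d$. If there is a regular map $X^0\to Y^0$, then for all $q\geq 1$, ${}_s\mathrm{TO}^q_X(r)\lesssim {}_s\mathrm{TO}^q_Y(r)$.
   Context: An abstract simplicial complex is a pair $(S,\mathcal S)$ where $\mathcal S$ is a collection of finite subsets of $S$ containing all singletons and closed under taking subsets; degree is $\max_{s}|\{t\neq s:\{s,t\}\in\mathcal S\}|$, dimension is $\max_{U\in\mathcal S}|U|-1$. A simplicial complex is the topological realisation $\{f:S\to[0,1]:\mathrm{supp}(f)\in\mathcal S,\sum_s f(s)=1\}$ (subspace topology of $[0,1]^S$); it is bounded degree if $S$ is countable and the degree is finite. It carries the metric $d(f,f')=\inf\{\sum_{i=1}^k\|f_{i-1}-f_i\|_2 : f_0=f, f_k=f', \mathrm{supp}(f_{i-1})\cup\mathrm{supp}(f_i)\in\mathcal S\}$. $X^0$ denotes the set of $0$-simplices with the shortest path metric of the $1$-skeleton; $|Z|$ is the number of $0$-simplices; closed simplices are sets of points whose support lies in a fixed element of $\mathcal S$; $Z\le X$ means there is an injection of $0$-simplices of $Z$ into those of $X$ sending simplices to simplices. For finite $Z$ and continuous $f:Z\to\mathbb R^q$, ${}_s\mathrm{Ov}(f)=\max_{z}|\{\sigma\text{ closed simplex of }Z: z\in f(\sigma)\}|$, ${}_s\mathrm{TO}^q(Z)=\min_f {}_s\mathrm{Ov}(f)$, and ${}_s\mathrm{TO}^q_X(r)=\max\{{}_s\mathrm{TO}^q(Z):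 Z\le X, |Z|\le r\}$. A map $X^0\to Y^0$ is regular if it is Lipschitz and preimages of points have uniformly bounded cardinality. A metric space $Y$ is uniformly $k$-connected if for every $s$ there is $S$ such that every continuous $f:S^{k-1}\to Y$ with image of diameter at most $s$ extends to a continuous $g:D^k\to Y$ with image of diameter at most $S$. For $f,g:\mathbb N\to[0,\infty)$, $f\lesssim g$ means there is $C$ with $f(r)\le Cg(Cr)+C$ for all $r$. *)

theory Defs
  imports "HOL-Analysis.Analysis" "HOL-Library.Extended_Nat"
begin

definition is_complex :: "'a set \<Rightarrow> 'a set set \<Rightarrow> bool" where
  "is_complex V S \<longleftrightarrow> (\<forall>U\<in>S. finite U \<and> U \<subseteq> V) \<and> (\<forall>v\<in>V. {v} \<in> S)
      \<and> (\<forall>U\<in>S. \<forall>W. W \<subseteq> U \<longrightarrow> W \<in> S)"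

definition bounded_degree :: "'a set \<Rightarrow> 'a set set \<Rightarrow> bool" where
  "bounded_degree V S \<longleftrightarrow> is_complex V S \<and> countable V \<and>
     (\<exists>D::nat. \<forall>s\<in>V. finite {t. t \<noteq> s \<and> {s,t} \<in> S} \<and> card {t. t \<noteq> s \<and> {s,t} \<in> S} \<le> D)"

definition has_dim :: "'a set set \<Rightarrow> nat \<Rightarrow> bool" where
  "has_dim S d \<longleftrightarrow> (\<forall>U\<in>S. card U \<le> Suc d) \<and> (\<exists>U\<in>S. card U = Suc d)"

definition supp :: "('a \<Rightarrow> real) \<Rightarrow> 'a set" where
  "supp f = {v. f v \<noteq> 0}"

(* topological realisation, as a subset of 'a => real (product topology) *)
definition realis :: "'a set \<Rightarrow> 'a set set \<Rightarrow> ('a \<Rightarrow> real) set" where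
  "realis V S = {f. (\<forall>v. 0 \<le> f v \<and> f v \<le> 1) \<and> supp f \<in> S \<and> sum f (supp f) = 1}"

definition closed_simplex :: "'a set \<Rightarrow> 'a set set \<Rightarrow> 'a set \<Rightarrow> ('a \<Rightarrow> real) set" where
  "closed_simplex V S \<sigma> = {f \<in> realis V S. supp f \<subseteq> \<sigma>}"

definition l2dist :: "('a \<Rightarrow> real) \<Rightarrow> ('a \<Rightarrow> real) \<Rightarrow> real" where
  "l2dist f g = sqrt (\<Sum>v\<in>supp f \<union> supp g. (f v - g v)^2)"

(* the metric d on the realisation (value \<infinity> if no chain exists) *)
definition cdist :: "'a set \<Rightarrow> 'a set set \<Rightarrow> ('a \<Rightarrow> real) \<Rightarrow> ('a \<Rightarrow> real) \<Rightarrow> ereal" where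
  "cdist V S f f' = Inf {ereal (\<Sum>i<k. l2dist (c i) (c (Suc i))) | k c.
      c 0 = f \<and> c k = f' \<and> (\<forall>i\<le>k. c i \<in> realis V S) \<and>
      (\<forall>i<k. supp (c i) \<union> supp (c (Suc i)) \<in> S)}"

(* R^k as functions nat => real vanishing from index k on *)
definition kdist :: "nat \<Rightarrow> (nat \<Rightarrow> real) \<Rightarrow> (nat \<Rightarrow> real) \<Rightarrow> real" where
  "kdist k x y = sqrt (\<Sum>i<k. (x i - y i)^2)"

definition ksphere :: "nat \<Rightarrow> (nat \<Rightarrow> real) set" where  (* S^{k-1} in R^k *)
  "ksphere k = {x. (\<forall>i\<ge>k. x i = 0) \<and> (\<Sum>i<k. (x i)^2) = 1}"

definition kdisc :: "nat \<Rightarrow> (nat \<Rightarrow> real) set" where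
  "kdisc k = {x. (\<forall>i\<ge>k. x i = 0) \<and> (\<Sum>i<k. (x i)^2) \<le> 1}"

definition metric_cont :: "'a set \<Rightarrow> 'a set set \<Rightarrow> nat \<Rightarrow> (nat \<Rightarrow> real) set
      \<Rightarrow> ((nat \<Rightarrow> real) \<Rightarrow> ('a \<Rightarrow> real)) \<Rightarrow> bool" where
  "metric_cont V S k A h \<longleftrightarrow> h ` A \<subseteq> realis V S \<and>
     (\<forall>x\<in>A. \<forall>e>0. \<exists>\<delta>>0. \<forall>y\<in>A. kdist k x y < \<delta> \<longrightarrow> cdist V S (h y) (h x) < ereal e)"

definition diam_le :: "'a set \<Rightarrow> 'a set set \<Rightarrow> ('a \<Rightarrow> real) set \<Rightarrow> real \<Rightarrow> bool" where
  "diam_le V S B s \<longleftrightarrow> (\<forall>x\<in>B. \<forall>y\<in>B. cdist V S x y \<le> ereal s)"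

definition unif_connected :: "'a set \<Rightarrow> 'a set set \<Rightarrow> nat \<Rightarrow> bool" where
  "unif_connected V S k \<longleftrightarrow> (\<forall>s::real. \<exists>T::real. \<forall>f.
      metric_cont V S k (ksphere k) f \<and> diam_le V S (f ` ksphere k) s \<longrightarrow>
      (\<exists>g. metric_cont V S k (kdisc k) g \<and> (\<forall>x\<in>ksphere k. g x = f x)
           \<and> diam_le V S (g ` kdisc k) T))"

definition edge_dist :: "'a set \<Rightarrow> 'a set set \<Rightarrow> 'a \<Rightarrow> 'a \<Rightarrow> enat" where
  "edge_dist V S x y = Inf {enat n | n. \<exists>p. p 0 = x \<and> p n = y \<and> (\<forall>i\<le>n. p i \<in> V)
       \<and> (\<forall>i<n. {p i, p (Suc i)} \<in> S)}"

definition regular_map :: "'a set \<Rightarrow> 'a set set \<Rightarrow> 'b set \<Rightarrow> 'b set set \<Rightarrow> ('a \<Rightarrow> 'b) \<Rightarrow> bool" where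
  "regular_map VX SX VY SY \<phi> \<longleftrightarrow> \<phi> ` VX \<subseteq> VY \<and>
     (\<exists>L::nat. \<forall>x\<in>VX. \<forall>y\<in>VX. edge_dist VY SY (\<phi> x) (\<phi> y) \<le> enat L * edge_dist VX SX x y) \<and>
     (\<exists>N::nat. \<forall>y. finite {x\<in>VX. \<phi> x = y} \<and> card {x\<in>VX. \<phi> x = y} \<le> N)"

definition complex_le :: "'a set \<Rightarrow> 'a set set \<Rightarrow> 'b set \<Rightarrow> 'b set set \<Rightarrow> bool" where
  "complex_le VZ SZ VX SX \<longleftrightarrow> (\<exists>g. inj_on g VZ \<and> g ` VZ \<subseteq> VX \<and> (\<forall>\<sigma>\<in>SZ. g ` \<sigma> \<in> SX))"

definition sOv :: "'a set \<Rightarrow> 'a set set \<Rightarrow> (('a \<Rightarrow> real) \<Rightarrow> real^'q) \<Rightarrow> nat" where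
  "sOv V S f = Sup {card {\<sigma>\<in>S. z \<in> f ` closed_simplex V S \<sigma>} | z. True}"

definition sTO :: "('q::finite) itself \<Rightarrow> 'a set \<Rightarrow> 'a set set \<Rightarrow> nat" where
  "sTO TYPE('q) V S = Inf {sOv V S f | f :: ('a \<Rightarrow> real) \<Rightarrow> real^'q. continuous_on (realis V S) f}"

definition sTO_X :: "('q::finite) itself \<Rightarrow> 'a set \<Rightarrow> 'a set set \<Rightarrow> nat \<Rightarrow> nat" where
  "sTO_X TYPE('q) VX SX r = Sup {sTO TYPE('q) VZ SZ | (VZ :: 'a set) SZ. is_complex VZ SZ \<and> finite VZ
       \<and> complex_le VZ SZ VX SX \<and> card VZ \<le> r}"

definition lesssim :: "(nat \<Rightarrow> nat) \<Rightarrow> (nat \<Rightarrow> nat) \<Rightarrow> bool" where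
  "lesssim f g \<longleftrightarrow> (\<exists>C::nat. \<forall>r. f r \<le> C * g (C * r) + C)"

end

theory Submission
  imports Defs
begin

text \<open>
  Uniform connectedness allows the vertex map to be extended, skeleton by skeleton, to a continuous
  map \<open>\<Phi>\<close> between the realisations that sends simplices to sets of uniformly bounded diameter.
  For a finite \<open>Z \<le> X\<close> the image of \<open>Z\<close> lies in a finite subcomplex \<open>W\<close> of \<open>Y\<close> with at most
  \<open>C |Z|\<close> vertices, and since vertex balls and fibres are uniformly bounded, every simplex of
  \<open>W\<close> is met by the images of at most \<open>C\<close> simplices of \<open>Z\<close>. Composing an optimal map on
  \<open>W\<close> with \<open>\<Phi>\<close> therefore increases the overlap by a factor of at most \<open>C\<close>.
\<close>

section \<open>Chains and the path metric\<close>

definition simplicial_chain :: "'a set \<Rightarrow> 'a set set \<Rightarrow> nat \<Rightarrow> (nat \<Rightarrow> 'a \<Rightarrow> real) \<Rightarrow> bool" where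
  "simplicial_chain V S k c \<longleftrightarrow>
     (\<forall>i\<le>k. c i \<in> realis V S) \<and> (\<forall>i<k. supp (c i) \<union> supp (c (Suc i)) \<in> S)"

definition chain_length :: "nat \<Rightarrow> (nat \<Rightarrow> 'a \<Rightarrow> real) \<Rightarrow> real" where
  "chain_length k c = (\<Sum>i<k. l2dist (c i) (c (Suc i)))"

definition append_chain :: "nat \<Rightarrow> (nat \<Rightarrow> 'a \<Rightarrow> real) \<Rightarrow> (nat \<Rightarrow> 'a \<Rightarrow> real) \<Rightarrow> nat \<Rightarrow> 'a \<Rightarrow> real" where
  "append_chain k c c' = (\<lambda>i. if i \<le> k then c i else c' (i - k))"

lemma l2dist_L2_set: "l2dist f g = L2_set (\<lambda>v. f v - g v) (supp f \<union> supp g)"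
  by (simp add: l2dist_def L2_set_def)

lemma l2dist_nonneg: "0 \<le> l2dist f g"
  by (simp add: l2dist_L2_set)

lemma l2dist_commute: "l2dist f g = l2dist g f"
  by (simp add: l2dist_def Un_commute power2_commute)

lemma l2dist_le_sum_abs:
  assumes "supp f \<union> supp g \<subseteq> A" "finite A"
  shows "l2dist f g \<le> (\<Sum>v\<in>A. \<bar>f v - g v\<bar>)"
proof -
  have "l2dist f g \<le> (\<Sum>v\<in>supp f \<union> supp g. \<bar>f v - g v\<bar>)"
    by (simp add: l2dist_L2_set L2_set_le_sum_abs)
  also have "\<dots> \<le> (\<Sum>v\<in>A. \<bar>f v - g v\<bar>)"
    using assms by (intro sum_mono2) auto
  finally show ?thesis .
qed

lemma abs_diff_le_l2dist:
  assumes "finite (supp f \<union> supp g)"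
  shows "\<bar>f v - g v\<bar> \<le> l2dist f g"
proof (cases "v \<in> supp f \<union> supp g")
  case True
  have "(f v - g v)\<^sup>2 \<le> (\<Sum>v\<in>supp f \<union> supp g. (f v - g v)\<^sup>2)"
    using assms True by (intro member_le_sum) auto
  then show ?thesis
    by (simp add: l2dist_def real_le_rsqrt)
qed (auto simp: supp_def l2dist_nonneg)

lemma chain_length_nonneg: "0 \<le> chain_length k c"
  by (simp add: chain_length_def l2dist_nonneg sum_nonneg)

lemma cdist_eq_Inf_chain_length:
  "cdist V S f g =
    Inf {ereal (chain_length k c) | k c. simplicial_chain V S k c \<and> c 0 = f \<and> c k = g}"
  unfolding cdist_def simplicial_chain_def chain_length_def by (rule arg_cong[of _ _ Inf]) blast

lemma cdist_le_chain_length: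
  "simplicial_chain V S k c \<Longrightarrow> cdist V S (c 0) (c k) \<le> ereal (chain_length k c)"
  unfolding cdist_eq_Inf_chain_length by (intro Inf_lower) blast

lemma le_cdistI:
  assumes "\<And>k c. \<lbrakk>simplicial_chain V S k c; c 0 = f; c k = g\<rbrakk> \<Longrightarrow> b \<le> ereal (chain_length k c)"
  shows "b \<le> cdist V S f g"
  unfolding cdist_eq_Inf_chain_length using assms by (intro Inf_greatest) blast

lemma simplicial_chain_rev:
  assumes "simplicial_chain V S k c"
  shows "simplicial_chain V S k (\<lambda>i. c (k - i))"
proof -
  have "supp (c (k - i)) \<union> supp (c (k - Suc i)) \<in> S" if i_less: "i < k" for i
  proof -
    have "supp (c (k - Suc i)) \<union> supp (c (Suc (k - Suc i))) \<in> S"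
      using assms i_less by (simp add: simplicial_chain_def)
    then show ?thesis using i_less by (simp add: Suc_diff_Suc Un_commute)
  qed
  then show ?thesis using assms by (simp add: simplicial_chain_def)
qed

lemma chain_length_rev: "chain_length k (\<lambda>i. c (k - i)) = chain_length k c"
proof -
  have "chain_length k (\<lambda>i. c (k - i)) = (\<Sum>i<k. l2dist (c (k - Suc i)) (c (Suc (k - Suc i))))"
    unfolding chain_length_def by (intro sum.cong) (simp_all add: Suc_diff_Suc l2dist_commute)
  also have "\<dots> = chain_length k c"
    unfolding chain_length_def by (rule sum.nat_diff_reindex)
  finally show ?thesis .
qed

lemma simplicial_chain_append:
  assumes "simplicial_chain V S k c" "simplicial_chain V S m c'" "c' 0 = c k"
  shows "simplicial_chain V S (k + m) (append_chain k c c')"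
  using assms unfolding simplicial_chain_def append_chain_def
  by (auto simp: not_le less_Suc_eq Suc_diff_le)

lemma chain_length_append:
  assumes "c' 0 = c k"
  shows "chain_length (k + m) (append_chain k c c') = chain_length k c + chain_length m c'"
proof (induction m)
  case 0
  show ?case by (simp add: chain_length_def append_chain_def)
next
  case (Suc m)
  then show ?case using assms by (cases m) (auto simp: chain_length_def append_chain_def)
qed

lemma cdist_nonneg: "0 \<le> cdist V S f g"
  by (rule le_cdistI) (simp add: chain_length_nonneg)

lemma cdist_self: "f \<in> realis V S \<Longrightarrow> cdist V S f f = 0"
  using cdist_le_chain_length[of V S 0 "\<lambda>_. f"] cdist_nonneg[of V S f f]
  by (simp add: simplicial_chain_def chain_length_def zero_ereal_def antisym)

lemma cdist_le_l2dist:
  assumes "f \<in> realis V S" "g \<in> realis V S" "supp f \<union> supp g \<in> S"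
  shows "cdist V S f g \<le> ereal (l2dist f g)"
  using cdist_le_chain_length[of V S 1 "\<lambda>i. if i = 0 then f else g"] assms
  by (simp add: simplicial_chain_def chain_length_def)

lemma cdist_commute: "cdist V S f g = cdist V S g f"
proof -
  have cdist_swap_le: "cdist V S y x \<le> cdist V S x y" for x y
  proof (rule le_cdistI)
    fix k c assume chain: "simplicial_chain V S k c" and "c 0 = x" "c k = y"
    then show "cdist V S y x \<le> ereal (chain_length k c)"
      using cdist_le_chain_length[OF simplicial_chain_rev[OF chain]] by (simp add: chain_length_rev)
  qed
  show ?thesis by (rule antisym[OF cdist_swap_le cdist_swap_le])
qed

lemma cdist_triangle: "cdist V S f h \<le> cdist V S f g + cdist V S g h"
proof (cases "cdist V S f g = \<infinity>")
  case False
  have via_chain: "cdist V S f h \<le> cdist V S f g + ereal (chain_length m c')"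
    if chain': "simplicial_chain V S m c'" "c' 0 = g" "c' m = h" for m c'
  proof -
    have "cdist V S f h - ereal (chain_length m c') \<le> cdist V S f g"
    proof (rule le_cdistI)
      fix k c assume chain: "simplicial_chain V S k c" "c 0 = f" "c k = g"
      have "append_chain k c c' 0 = f" "append_chain k c c' (k + m) = h"
        using chain chain' by (auto simp: append_chain_def)
      then have "cdist V S f h \<le> ereal (chain_length k c + chain_length m c')"
        using cdist_le_chain_length[OF simplicial_chain_append[OF chain(1) chain'(1)]] chain chain'
        by (simp add: chain_length_append)
      then show "cdist V S f h - ereal (chain_length m c') \<le> ereal (chain_length k c)"
        by (simp add: ereal_minus_le)
    qed
    then show ?thesis by (simp add: ereal_minus_le)
  qed
  have finite: "\<bar>cdist V S f g\<bar> \<noteq> \<infinity>"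
    using False cdist_nonneg[of V S f g] by auto
  have "cdist V S f h - cdist V S f g \<le> cdist V S g h"
    by (rule le_cdistI) (use via_chain finite in \<open>simp add: ereal_minus_le add.commute\<close>)
  then show ?thesis using finite by (simp add: ereal_minus_le add.commute)
qed simp

lemma lipschitz_le_cdist:
  fixes H :: "('a \<Rightarrow> real) \<Rightarrow> 'm::metric_space"
  assumes "\<And>x y. \<lbrakk>x \<in> realis V S; y \<in> realis V S; supp x \<union> supp y \<in> S\<rbrakk>
      \<Longrightarrow> dist (H x) (H y) \<le> K * l2dist x y"
    and "K > 0"
  shows "ereal (dist (H f) (H g) / K) \<le> cdist V S f g"
proof (rule le_cdistI)
  fix k c assume chain: "simplicial_chain V S k c" "c 0 = f" "c k = g"
  have "dist (H (c 0)) (H (c k)) \<le> (\<Sum>i<k. dist (H (c i)) (H (c (Suc i))))"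
  proof (induction k)
    case (Suc k)
    then show ?case
      using dist_triangle[of "H (c 0)" "H (c (Suc k))" "H (c k)"] by simp
  qed simp
  also have "\<dots> \<le> (\<Sum>i<k. K * l2dist (c i) (c (Suc i)))"
    using chain(1) by (intro sum_mono assms(1)) (auto simp: simplicial_chain_def)
  also have "\<dots> = K * chain_length k c"
    by (simp add: chain_length_def sum_distrib_left)
  finally show "ereal (dist (H f) (H g) / K) \<le> ereal (chain_length k c)"
    using chain(2,3) \<open>K > 0\<close> by (simp add: field_simps)
qed

section \<open>The metric topology is the product topology\<close>

lemma simplex_subset: "is_complex V S \<Longrightarrow> \<sigma> \<in> S \<Longrightarrow> \<tau> \<subseteq> \<sigma> \<Longrightarrow> \<tau> \<in> S"
  by (simp add: is_complex_def)

lemma simplex_finite: "is_complex V S \<Longrightarrow> \<sigma> \<in> S \<Longrightarrow> finite \<sigma>"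
  by (simp add: is_complex_def)

lemma simplex_vertices: "is_complex V S \<Longrightarrow> \<sigma> \<in> S \<Longrightarrow> \<sigma> \<subseteq> V"
  by (simp add: is_complex_def)

lemma realis_nonneg: "f \<in> realis V S \<Longrightarrow> 0 \<le> f v"
  by (simp add: realis_def)

lemma realis_supp: "f \<in> realis V S \<Longrightarrow> supp f \<in> S"
  by (simp add: realis_def)

lemma realis_supp_nonempty: "f \<in> realis V S \<Longrightarrow> supp f \<noteq> {}"
  by (auto simp: realis_def)

lemma realis_finite_supp: "is_complex V S \<Longrightarrow> f \<in> realis V S \<Longrightarrow> finite (supp f)"
  by (rule simplex_finite[OF _ realis_supp])

lemma realis_sum_superset:
  assumes "f \<in> realis V S" "finite A" "supp f \<subseteq> A"
  shows "sum f A = 1"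
  using assms by (subst sum.mono_neutral_right[of A "supp f"]) (auto simp: realis_def supp_def)

lemma abs_diff_le_cdist:
  assumes "is_complex V S"
  shows "ereal \<bar>f v - g v\<bar> \<le> cdist V S f g"
proof -
  have "dist (x v) (y v) \<le> 1 * l2dist x y" if "supp x \<union> supp y \<in> S" for x y :: "'a \<Rightarrow> real"
    using abs_diff_le_l2dist[OF simplex_finite[OF assms that]] by (simp add: dist_real_def)
  then show ?thesis
    using lipschitz_le_cdist[of V S "\<lambda>x. x v" 1] by (simp add: dist_real_def)
qed

text \<open>Since both points have total mass 1, the mass of \<open>y\<close> off the support of \<open>x\<close> is
  what \<open>y\<close> lacks on it.\<close>

lemma l2dist_le_sum_supp:
  assumes "is_complex V S" "x \<in> realis V S" "y \<in> realis V S" "supp x \<subseteq> supp y"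
  shows "l2dist x y \<le> 2 * (\<Sum>v\<in>supp x. \<bar>x v - y v\<bar>)"
proof -
  have finite_supp: "finite (supp y)"
    using assms realis_finite_supp by blast
  have "(\<Sum>v\<in>supp y - supp x. \<bar>x v - y v\<bar>) = (\<Sum>v\<in>supp y - supp x. y v)"
    using assms by (intro sum.cong) (auto simp: supp_def realis_nonneg)
  also have "\<dots> = sum y (supp y) - sum y (supp x)"
    using finite_supp assms(4) by (rule sum_diff)
  also have "\<dots> = (\<Sum>v\<in>supp x. x v - y v)"
    using assms by (simp add: sum_subtractf realis_def)
  also have "\<dots> \<le> (\<Sum>v\<in>supp x. \<bar>x v - y v\<bar>)"
    by (intro sum_mono) auto
  finally have off_supp: "(\<Sum>v\<in>supp y - supp x. \<bar>x v - y v\<bar>) \<le> (\<Sum>v\<in>supp x. \<bar>x v - y v\<bar>)" .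
  have "l2dist x y \<le> (\<Sum>v\<in>supp y. \<bar>x v - y v\<bar>)"
    using assms(4) finite_supp by (intro l2dist_le_sum_abs) auto
  also have "\<dots> = (\<Sum>v\<in>supp y - supp x. \<bar>x v - y v\<bar>) + (\<Sum>v\<in>supp x. \<bar>x v - y v\<bar>)"
    using assms(4) finite_supp by (rule sum.subset_diff)
  finally show ?thesis using off_supp by simp
qed

lemma tendsto_fun_iff:
  fixes y :: "'n \<Rightarrow> 'i \<Rightarrow> 'c::topological_space"
  shows "(y \<longlongrightarrow> x) F \<longleftrightarrow> (\<forall>i. ((\<lambda>n. y n i) \<longlongrightarrow> x i) F)"
  using limitin_componentwise[of "\<lambda>_. euclidean" UNIV y x F]
  by (simp add: euclidean_product_topology)

lemma eventually_cdist_less: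
  assumes complex: "is_complex V S" and x_in: "x \<in> realis V S"
    and y_in: "\<forall>\<^sub>F n in F. y n \<in> realis V S"
    and converges: "(y \<longlongrightarrow> x) F" and "e > 0"
  shows "\<forall>\<^sub>F n in F. cdist V S (y n) x < ereal e"
proof -
  have coordinate_converges: "((\<lambda>n. y n v) \<longlongrightarrow> x v) F" for v
    using converges by (simp add: tendsto_fun_iff)
  have positive_on_supp: "\<forall>\<^sub>F n in F. \<forall>v\<in>supp x. 0 < y n v"
  proof (intro eventually_ball_finite ballI)
    fix v assume "v \<in> supp x"
    then have "0 < x v"
      using realis_nonneg[OF x_in, of v] by (auto simp: supp_def less_le)
    then show "\<forall>\<^sub>F n in F. 0 < y n v"
      by (rule order_tendstoD(1)[OF coordinate_converges])
  qed (rule realis_finite_supp[OF complex x_in])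
  have "((\<lambda>n. 2 * (\<Sum>v\<in>supp x. \<bar>x v - y n v\<bar>)) \<longlongrightarrow> 2 * (\<Sum>v\<in>supp x. \<bar>x v - x v\<bar>)) F"
    by (intro tendsto_intros coordinate_converges)
  then have "\<forall>\<^sub>F n in F. 2 * (\<Sum>v\<in>supp x. \<bar>x v - y n v\<bar>) < e"
    using \<open>e > 0\<close> by (intro order_tendstoD(2)) simp_all
  with positive_on_supp y_in show ?thesis
  proof eventually_elim
    case (elim n)
    have supp_subset: "supp x \<subseteq> supp (y n)" using elim(1) by (auto simp: supp_def)
    then have "cdist V S (y n) x \<le> ereal (l2dist x (y n))"
      using cdist_le_l2dist[of "y n" V S x] elim(2) x_in realis_supp[OF elim(2)]
      by (simp add: l2dist_commute Un_absorb2)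
    also have "\<dots> \<le> ereal (2 * (\<Sum>v\<in>supp x. \<bar>x v - y n v\<bar>))"
      using l2dist_le_sum_supp[OF complex x_in elim(2) supp_subset] by simp
    also have "\<dots> < ereal e" using elim(3) by simp
    finally show ?case .
  qed
qed

lemma tendsto_realis_iff_cdist:
  assumes complex: "is_complex V S" and x_in: "x \<in> realis V S"
    and y_in: "\<forall>\<^sub>F n in F. y n \<in> realis V S"
  shows "(y \<longlongrightarrow> x) F \<longleftrightarrow> (\<forall>e>0. \<forall>\<^sub>F n in F. cdist V S (y n) x < ereal e)" (is "?lim \<longleftrightarrow> ?cdist")
proof
  assume ?cdist
  show ?lim
    unfolding tendsto_fun_iff tendsto_iff
  proof (intro allI impI)
    fix v and e :: real assume "e > 0"
    with \<open>?cdist\<close> have "\<forall>\<^sub>F n in F. cdist V S (y n) x < ereal e" by blast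
    then show "\<forall>\<^sub>F n in F. dist (y n v) (x v) < e"
    proof eventually_elim
      case (elim n)
      have "ereal \<bar>y n v - x v\<bar> < ereal e"
        using abs_diff_le_cdist[OF complex] elim by (rule le_less_trans)
      then show ?case by (simp add: dist_real_def)
    qed
  qed
qed (use eventually_cdist_less[OF complex x_in y_in] in blast)

lemma kdist_nonneg: "0 \<le> kdist k x y"
  by (simp add: kdist_def sum_nonneg)

lemma kdist_self: "kdist k x x = 0"
  by (simp add: kdist_def)

lemma abs_diff_le_kdist:
  assumes "i < k"
  shows "\<bar>x i - y i\<bar> \<le> kdist k x y"
proof -
  have "(x i - y i)\<^sup>2 \<le> (\<Sum>i<k. (x i - y i)\<^sup>2)"
    using assms by (intro member_le_sum) auto
  then show ?thesis
    by (simp add: kdist_def real_le_rsqrt)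
qed

lemma continuous_on_coordinate:
  "continuous_on A (\<lambda>x :: 'i \<Rightarrow> 'c::topological_space. x i)"
  by (rule continuous_on_subset[OF continuous_on_product_coordinates]) simp

lemma filtercomap_kdist_le_nhds_within:
  assumes x_in: "x \<in> A" and A_subset: "A \<subseteq> {y. \<forall>i\<ge>k. y i = 0}"
  shows "inf (filtercomap (kdist k x) (nhds 0)) (principal A) \<le> inf (nhds x) (principal A)"
    (is "?F \<le> _")
proof -
  have kdist_lim: "(kdist k x \<longlongrightarrow> 0) ?F"
    by (rule filterlim_mono[OF filterlim_filtercomap order_refl inf_le1])
  have in_A: "\<forall>\<^sub>F y in ?F. y \<in> A"
    by (simp add: eventually_inf_principal)
  have "((\<lambda>y. y i) \<longlongrightarrow> x i) ?F" for i
  proof (cases "i < k")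
    case True
    have "((\<lambda>y. y i - x i) \<longlongrightarrow> 0) ?F"
      by (rule Lim_null_comparison[OF _ kdist_lim])
        (use abs_diff_le_kdist[OF True, of x] in \<open>simp add: abs_minus_commute\<close>)
    then show ?thesis by (simp add: LIM_zero_iff)
  next
    case False
    then have vanish: "y i = 0" if "y \<in> A" for y
      using subsetD[OF A_subset that] by simp
    have "\<forall>\<^sub>F y in ?F. y i = x i"
      using in_A by eventually_elim (simp add: vanish x_in)
    then show ?thesis by (rule tendsto_eventually)
  qed
  then have "((\<lambda>y. y) \<longlongrightarrow> x) ?F"
    by (simp add: tendsto_fun_iff)
  then show ?thesis
    by (simp add: filterlim_def filtermap_ident)
qed

lemma eventually_nhds_within_kdist_iff:
  assumes "x \<in> A" and "A \<subseteq> {y. \<forall>i\<ge>k. y i = 0}"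
  shows "eventually P (inf (nhds x) (principal A)) \<longleftrightarrow> (\<exists>\<delta>>0. \<forall>y\<in>A. kdist k x y < \<delta> \<longrightarrow> P y)"
proof
  assume "\<exists>\<delta>>0. \<forall>y\<in>A. kdist k x y < \<delta> \<longrightarrow> P y"
  then obtain \<delta> where "\<delta> > 0" and near: "\<forall>y\<in>A. kdist k x y < \<delta> \<longrightarrow> P y" by blast
  have "continuous_on UNIV (kdist k x)"
    unfolding kdist_def by (intro continuous_intros continuous_on_coordinate)
  then have "(kdist k x \<longlongrightarrow> kdist k x x) (nhds x)"
    by (simp add: continuous_on_eq_continuous_at continuous_within tendsto_at_iff_tendsto_nhds)
  then have "\<forall>\<^sub>F y in nhds x. kdist k x y < \<delta>"
    using \<open>\<delta> > 0\<close> by (intro order_tendstoD(2)) (simp_all add: kdist_self)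
  then show "eventually P (inf (nhds x) (principal A))"
    unfolding eventually_inf_principal by eventually_elim (use near in blast)
next
  assume "eventually P (inf (nhds x) (principal A))"
  with filtercomap_kdist_le_nhds_within[OF assms]
  have "eventually P (inf (filtercomap (kdist k x) (nhds 0)) (principal A))"
    by (rule filter_leD)
  then show "\<exists>\<delta>>0. \<forall>y\<in>A. kdist k x y < \<delta> \<longrightarrow> P y"
    unfolding eventually_inf_principal eventually_filtercomap eventually_nhds_metric
    by (fastforce simp: kdist_nonneg dist_real_def)
qed

lemma metric_cont_iff_continuous_on:
  assumes complex: "is_complex V S" and h_image: "h ` A \<subseteq> realis V S"
    and A_subset: "A \<subseteq> {y. \<forall>i\<ge>k. y i = 0}"
  shows "metric_cont V S k A h \<longleftrightarrow> continuous_on A h"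
proof -
  have "continuous_on A h \<longleftrightarrow> (\<forall>x\<in>A. (h \<longlongrightarrow> h x) (inf (nhds x) (principal A)))"
    by (simp add: continuous_on_def tendsto_at_iff_tendsto_nhds_within)
  also have "\<dots> \<longleftrightarrow> (\<forall>x\<in>A. \<forall>e>0. \<forall>\<^sub>F y in inf (nhds x) (principal A). cdist V S (h y) (h x) < ereal e)"
    using h_image by (intro ball_cong tendsto_realis_iff_cdist[OF complex])
      (auto simp: eventually_inf_principal image_subset_iff)
  also have "\<dots> \<longleftrightarrow> metric_cont V S k A h"
    using h_image by (simp add: metric_cont_def eventually_nhds_within_kdist_iff[OF _ A_subset])
  finally show ?thesis by simp
qed

section \<open>Closed simplices and discs\<close>

definition simplex_boundary :: "'a set \<Rightarrow> 'a set set \<Rightarrow> 'a set \<Rightarrow> ('a \<Rightarrow> real) set" where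
  "simplex_boundary V S \<sigma> = {x \<in> closed_simplex V S \<sigma>. supp x \<noteq> \<sigma>}"

lemma closed_simplex_realis: "x \<in> closed_simplex V S \<sigma> \<Longrightarrow> x \<in> realis V S"
  by (simp add: closed_simplex_def)

lemma closed_simplex_supp: "x \<in> closed_simplex V S \<sigma> \<Longrightarrow> supp x \<subseteq> \<sigma>"
  by (simp add: closed_simplex_def)

lemma realis_in_closed_simplex_supp: "x \<in> realis V S \<Longrightarrow> x \<in> closed_simplex V S (supp x)"
  by (simp add: closed_simplex_def)

lemma realis_eq_Union: "realis V S = (\<Union>\<sigma>\<in>S. closed_simplex V S \<sigma>)"
  by (auto intro: realis_in_closed_simplex_supp realis_supp dest: closed_simplex_realis)

lemma closed_simplex_eq:
  assumes "is_complex V S" "\<sigma> \<in> S"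
  shows "closed_simplex V S \<sigma> = {f. (\<forall>v. 0 \<le> f v) \<and> (\<forall>v. v \<notin> \<sigma> \<longrightarrow> f v = 0) \<and> sum f \<sigma> = 1}"
    (is "_ = ?R")
proof (intro equalityI subsetI)
  fix f assume f_in: "f \<in> closed_simplex V S \<sigma>"
  have "0 \<le> f v" and "v \<notin> \<sigma> \<longrightarrow> f v = 0" for v
    using realis_nonneg[OF closed_simplex_realis[OF f_in]] closed_simplex_supp[OF f_in]
    by (auto simp: supp_def)
  moreover have "sum f \<sigma> = 1"
    using closed_simplex_realis[OF f_in] simplex_finite[OF assms] closed_simplex_supp[OF f_in]
    by (rule realis_sum_superset)
  ultimately show "f \<in> ?R" by blast
next
  fix f assume f_in: "f \<in> ?R"
  then have supp_subset: "supp f \<subseteq> \<sigma>" by (auto simp: supp_def)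
  have finite_simplex: "finite \<sigma>" using simplex_finite[OF assms] .
  have "f v \<le> 1" for v
  proof (cases "v \<in> \<sigma>")
    case True
    then show ?thesis using member_le_sum[of v \<sigma> f] f_in finite_simplex by simp
  qed (use f_in in simp)
  moreover have "sum f (supp f) = sum f \<sigma>"
    using supp_subset finite_simplex by (intro sum.mono_neutral_left) (auto simp: supp_def)
  ultimately show "f \<in> closed_simplex V S \<sigma>"
    using f_in supp_subset simplex_subset[OF assms supp_subset]
    by (simp add: closed_simplex_def realis_def)
qed

lemma closed_closed_simplex:
  assumes "is_complex V S" "\<sigma> \<in> S"
  shows "closed (closed_simplex V S \<sigma>)"
  unfolding closed_simplex_eq[OF assms]
  by (intro closed_Collect_conj closed_Collect_all closed_Collect_imp closed_Collect_le
      closed_Collect_eq continuous_on_sum continuous_on_const continuous_on_coordinate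
      open_Collect_const)

lemma continuous_on_Min_image:
  fixes f :: "'i \<Rightarrow> 'c::topological_space \<Rightarrow> real"
  assumes "finite I" "I \<noteq> {}" "\<And>i. i \<in> I \<Longrightarrow> continuous_on A (f i)"
  shows "continuous_on A (\<lambda>x. Min ((\<lambda>i. f i x) ` I))"
  using assms
proof (induction I rule: finite_ne_induct)
  case (insert i I)
  then have "continuous_on A (\<lambda>x. min (f i x) (Min ((\<lambda>i. f i x) ` I)))"
    by (intro continuous_on_min) auto
  then show ?case using insert by simp
qed simp

lemma ksphere_eq_L2_set: "ksphere k = {x. (\<forall>i\<ge>k. x i = 0) \<and> L2_set x {..<k} = 1}"
  by (simp add: ksphere_def L2_set_def)

lemma kdisc_eq_L2_set: "kdisc k = {x. (\<forall>i\<ge>k. x i = 0) \<and> L2_set x {..<k} \<le> 1}"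
  by (simp add: kdisc_def L2_set_def)

text \<open>Subtracting the last barycentric coordinate identifies the simplex with a convex body in
  \<open>\<real>^k\<close> around the image \<open>0\<close> of the barycentre, and the smallest barycentric coordinate vanishes
  exactly on the boundary. The map \<open>boundary_map\<close> inverts \<open>disc_map\<close> only on the boundary, which is
  all that is needed to fill boundaries.\<close>

locale enumerated_simplex =
  fixes V :: "'a set" and S :: "'a set set" and \<sigma> :: "'a set" and k :: nat and e :: "nat \<Rightarrow> 'a"
  assumes complex: "is_complex V S" and simplex: "\<sigma> \<in> S" and enum: "bij_betw e {..k} \<sigma>"
begin

definition offset :: "('a \<Rightarrow> real) \<Rightarrow> nat \<Rightarrow> real" where
  "offset t i = (if i < k then t (e i) - t (e k) else 0)"

definition min_weight :: "('a \<Rightarrow> real) \<Rightarrow> real" where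
  "min_weight t = Min (t ` \<sigma>)"

definition disc_map :: "('a \<Rightarrow> real) \<Rightarrow> nat \<Rightarrow> real" where
  "disc_map t = (\<lambda>i. offset t i / (L2_set (offset t) {..<k} + min_weight t))"

definition min_coord :: "(nat \<Rightarrow> real) \<Rightarrow> real" where
  "min_coord x = Min (x ` {..k})"

definition excess :: "(nat \<Rightarrow> real) \<Rightarrow> real" where
  "excess x = (\<Sum>i\<le>k. x i - min_coord x)"

definition boundary_map :: "(nat \<Rightarrow> real) \<Rightarrow> 'a \<Rightarrow> real" where
  "boundary_map x v = (if v \<in> \<sigma> then (x (inv_into {..k} e v) - min_coord x) / excess x else 0)"

lemma finite_simplex: "finite \<sigma>"
  using simplex_finite[OF complex simplex] .

lemma vertex_cases:
  assumes "v \<in> \<sigma>"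
  obtains i where "i \<le> k" "v = e i"
  using assms enum by (auto simp: bij_betw_def)

lemma enum_in: "i \<le> k \<Longrightarrow> e i \<in> \<sigma>"
  using enum by (auto simp: bij_betw_def)

lemma simplex_nonempty: "\<sigma> \<noteq> {}"
  using enum_in by blast

lemma sum_enum: "sum f \<sigma> = (\<Sum>i\<le>k. f (e i))"
  using sum.reindex_bij_betw[OF enum, of f] by simp

lemma closed_simplexD:
  assumes "t \<in> closed_simplex V S \<sigma>"
  shows "0 \<le> t v" "v \<notin> \<sigma> \<Longrightarrow> t v = 0" "sum t \<sigma> = 1"
  using assms unfolding closed_simplex_eq[OF complex simplex] by simp_all

lemma min_weight_attained: obtains i where "i \<le> k" "t (e i) = min_weight t"
proof -
  have "min_weight t \<in> t ` \<sigma>"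
    unfolding min_weight_def using finite_simplex simplex_nonempty by (intro Min_in) auto
  then show thesis using that by (auto elim: vertex_cases)
qed

lemma min_weight_nonneg: "t \<in> closed_simplex V S \<sigma> \<Longrightarrow> 0 \<le> min_weight t"
  using finite_simplex simplex_nonempty by (simp add: min_weight_def closed_simplexD(1))

lemma min_weight_boundary:
  assumes "t \<in> simplex_boundary V S \<sigma>"
  shows "min_weight t = 0"
proof -
  have t_in: "t \<in> closed_simplex V S \<sigma>" and "supp t \<noteq> \<sigma>"
    using assms by (simp_all add: simplex_boundary_def)
  then obtain v where "v \<in> \<sigma>" "t v = 0"
    using closed_simplex_supp by (fastforce simp: supp_def)
  then have "min_weight t \<le> t v"
    unfolding min_weight_def using finite_simplex by (intro Min_le) auto
  with \<open>t v = 0\<close> show ?thesis using min_weight_nonneg[OF t_in] by simp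
qed

lemma L2_offset_add_min_weight_pos:
  assumes t_in: "t \<in> closed_simplex V S \<sigma>"
  shows "0 < L2_set (offset t) {..<k} + min_weight t"
proof (rule ccontr)
  assume "\<not> ?thesis"
  then have "L2_set (offset t) {..<k} = 0" "min_weight t = 0"
    using L2_set_nonneg[of "offset t" "{..<k}"] min_weight_nonneg[OF t_in] by linarith+
  then have "\<forall>i<k. t (e i) = t (e k)"
    by (simp add: L2_set_eq_0_iff offset_def)
  moreover obtain j where "j \<le> k" "t (e j) = min_weight t"
    by (rule min_weight_attained)
  ultimately have "t (e i) = 0" if "i \<le> k" for i
    using that \<open>min_weight t = 0\<close> by (metis le_neq_implies_less)
  then have "sum t \<sigma> = 0"
    by (simp add: sum_enum)
  then show False using closed_simplexD(3)[OF t_in] by simp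
qed

lemma continuous_on_disc_map: "continuous_on (closed_simplex V S \<sigma>) disc_map"
proof (rule continuous_on_coordinatewise_then_product)
  fix i
  have offset: "continuous_on A (\<lambda>t. offset t i)" for A i
    unfolding offset_def
    by (cases "i < k") (auto intro!: continuous_intros continuous_on_coordinate)
  have min_weight: "continuous_on A min_weight" for A
    unfolding min_weight_def
    using finite_simplex simplex_nonempty
    by (intro continuous_on_Min_image continuous_on_coordinate)
  have norm: "continuous_on A (\<lambda>t. L2_set (offset t) {..<k})" for A
    unfolding L2_set_def by (intro continuous_intros offset)
  have "\<forall>t\<in>closed_simplex V S \<sigma>. L2_set (offset t) {..<k} + min_weight t \<noteq> 0"
    using L2_offset_add_min_weight_pos by (metis less_irrefl)
  then show "continuous_on (closed_simplex V S \<sigma>) (\<lambda>t. disc_map t i)"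
    unfolding disc_map_def by (intro continuous_intros offset norm min_weight)
qed

lemma L2_disc_map:
  assumes "t \<in> closed_simplex V S \<sigma>"
  shows "L2_set (disc_map t) {..<k}
    = L2_set (offset t) {..<k} / (L2_set (offset t) {..<k} + min_weight t)"
  using L2_offset_add_min_weight_pos[OF assms]
  by (simp add: disc_map_def divide_inverse L2_set_left_distrib)

lemma disc_map_in_kdisc: "t \<in> closed_simplex V S \<sigma> \<Longrightarrow> disc_map t \<in> kdisc k"
  using L2_offset_add_min_weight_pos[of t] min_weight_nonneg[of t]
  by (simp add: kdisc_eq_L2_set L2_disc_map) (simp add: disc_map_def offset_def)

lemma disc_map_in_ksphere: "t \<in> simplex_boundary V S \<sigma> \<Longrightarrow> disc_map t \<in> ksphere k"
  using L2_offset_add_min_weight_pos[of t] min_weight_boundary[of t]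
  by (simp add: simplex_boundary_def ksphere_eq_L2_set L2_disc_map)
    (simp add: disc_map_def offset_def)

lemma min_coord_le: "i \<le> k \<Longrightarrow> min_coord x \<le> x i"
  by (auto simp: min_coord_def intro: Min_le)

lemma min_coord_attained: obtains i where "i \<le> k" "x i = min_coord x"
proof -
  have "min_coord x \<in> x ` {..k}"
    unfolding min_coord_def by (rule Min_in) auto
  then show thesis using that by auto
qed

lemma excess_pos:
  assumes x_in: "x \<in> ksphere k"
  shows "0 < excess x"
proof -
  have "excess x \<noteq> 0"
  proof
    assume "excess x = 0"
    then have "\<forall>i\<le>k. x i = min_coord x"
      using sum_nonneg_eq_0_iff[of "{..k}" "\<lambda>i. x i - min_coord x"] min_coord_le[of _ x]
      by (simp add: excess_def)
    moreover have "x k = 0" using x_in by (simp add: ksphere_eq_L2_set)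
    ultimately have "\<forall>i<k. x i = 0" by (metis le_refl less_imp_le)
    then have "L2_set x {..<k} = 0" by (simp add: L2_set_eq_0_iff)
    then show False using x_in by (simp add: ksphere_eq_L2_set)
  qed
  moreover have "0 \<le> excess x"
    unfolding excess_def by (intro sum_nonneg) (simp add: min_coord_le)
  ultimately show ?thesis by simp
qed

lemma boundary_map_enum:
  assumes "i \<le> k"
  shows "boundary_map x (e i) = (x i - min_coord x) / excess x"
proof -
  have "inv_into {..k} e (e i) = i"
    using assms enum by (intro inv_into_f_f) (auto simp: bij_betw_def)
  then show ?thesis using enum_in[OF assms] by (simp add: boundary_map_def)
qed

lemma continuous_on_boundary_map: "continuous_on (ksphere k) boundary_map"
proof (rule continuous_on_coordinatewise_then_product)
  fix v
  have min_coord: "continuous_on A min_coord" for A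
    unfolding min_coord_def by (intro continuous_on_Min_image continuous_on_coordinate) auto
  have excess: "continuous_on A excess" for A
    unfolding excess_def by (intro continuous_intros min_coord continuous_on_coordinate)
  have "\<forall>x\<in>ksphere k. excess x \<noteq> 0"
    using excess_pos by (metis less_irrefl)
  then show "continuous_on (ksphere k) (\<lambda>x. boundary_map x v)"
    unfolding boundary_map_def
    by (cases "v \<in> \<sigma>") (auto intro!: continuous_intros min_coord excess continuous_on_coordinate)
qed

lemma boundary_map_in_boundary:
  assumes x_in: "x \<in> ksphere k"
  shows "boundary_map x \<in> simplex_boundary V S \<sigma>"
proof -
  have off_simplex: "boundary_map x v = 0" if "v \<notin> \<sigma>" for v
    using that by (simp add: boundary_map_def)
  have nonneg: "0 \<le> boundary_map x v" for v
  proof (cases "v \<in> \<sigma>")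
    case True
    then obtain i where "i \<le> k" "v = e i" by (rule vertex_cases)
    then show ?thesis using excess_pos[OF x_in] min_coord_le by (simp add: boundary_map_enum)
  qed (simp add: off_simplex)
  have "sum (boundary_map x) \<sigma> = (\<Sum>i\<le>k. x i - min_coord x) / excess x"
    by (simp add: sum_enum boundary_map_enum sum_divide_distrib)
  also have "\<dots> = 1"
    using excess_pos[OF x_in] by (simp add: excess_def)
  finally have "boundary_map x \<in> closed_simplex V S \<sigma>"
    using nonneg off_simplex by (simp add: closed_simplex_eq[OF complex simplex])
  moreover obtain i where minimal: "i \<le> k" "x i = min_coord x"
    by (rule min_coord_attained)
  then have "e i \<notin> supp (boundary_map x)"
    by (simp add: supp_def boundary_map_enum)
  ultimately show ?thesis
    using enum_in[OF minimal(1)] by (auto simp: simplex_boundary_def)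
qed

lemma disc_map_boundary:
  assumes "t \<in> simplex_boundary V S \<sigma>" "i \<le> k"
  shows "disc_map t i = (t (e i) - t (e k)) / L2_set (offset t) {..<k}"
  using assms(2) min_weight_boundary[OF assms(1)]
  by (cases "i = k") (simp_all add: disc_map_def offset_def)

lemma L2_offset_pos_boundary:
  assumes "t \<in> simplex_boundary V S \<sigma>"
  shows "0 < L2_set (offset t) {..<k}"
  using L2_offset_add_min_weight_pos[of t] min_weight_boundary[OF assms] assms
  by (simp add: simplex_boundary_def)

lemma min_coord_disc_map:
  assumes t_in: "t \<in> simplex_boundary V S \<sigma>"
  shows "min_coord (disc_map t) = - t (e k) / L2_set (offset t) {..<k}"
proof (rule antisym)
  obtain j where "j \<le> k" "t (e j) = min_weight t"
    by (rule min_weight_attained)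
  then show "min_coord (disc_map t) \<le> - t (e k) / L2_set (offset t) {..<k}"
    using min_coord_le[of j "disc_map t"] by (simp add: disc_map_boundary t_in min_weight_boundary)
  obtain i where "i \<le> k" "disc_map t i = min_coord (disc_map t)"
    by (rule min_coord_attained)
  moreover have "0 \<le> t (e i)"
    using t_in closed_simplexD(1) by (simp add: simplex_boundary_def)
  ultimately show "- t (e k) / L2_set (offset t) {..<k} \<le> min_coord (disc_map t)"
    using disc_map_boundary[OF t_in, of i] L2_offset_pos_boundary[OF t_in]
    by (simp add: divide_simps)
qed

lemma boundary_map_disc_map:
  assumes t_in: "t \<in> simplex_boundary V S \<sigma>"
  shows "boundary_map (disc_map t) = t"
proof
  fix v
  define N where "N = L2_set (offset t) {..<k}"
  have "N > 0" unfolding N_def by (rule L2_offset_pos_boundary[OF t_in])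
  have t_in_simplex: "t \<in> closed_simplex V S \<sigma>" using t_in by (simp add: simplex_boundary_def)
  have shifted: "disc_map t i - min_coord (disc_map t) = t (e i) / N" if "i \<le> k" for i
    by (simp add: disc_map_boundary[OF t_in that] min_coord_disc_map[OF t_in] diff_divide_distrib
        N_def)
  have "excess (disc_map t) = (\<Sum>i\<le>k. t (e i)) / N"
    by (simp add: excess_def shifted sum_divide_distrib)
  then have excess: "excess (disc_map t) = 1 / N"
    using closed_simplexD(3)[OF t_in_simplex] by (simp add: sum_enum)
  show "boundary_map (disc_map t) v = t v"
  proof (cases "v \<in> \<sigma>")
    case True
    then obtain i where "i \<le> k" "v = e i" by (rule vertex_cases)
    then show ?thesis using \<open>N > 0\<close> by (simp add: boundary_map_enum shifted excess)
  qed (simp add: boundary_map_def closed_simplexD(2)[OF t_in_simplex])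
qed

end

lemma simplex_disc_maps:
  assumes simplex: "is_complex V S" "\<sigma> \<in> S" and card: "card \<sigma> = Suc k"
  obtains q p where
    "continuous_on (closed_simplex V S \<sigma>) q" "q ` closed_simplex V S \<sigma> \<subseteq> kdisc k"
    "continuous_on (ksphere k) p" "p ` ksphere k \<subseteq> simplex_boundary V S \<sigma>"
    "q ` simplex_boundary V S \<sigma> \<subseteq> ksphere k" "\<And>x. x \<in> simplex_boundary V S \<sigma> \<Longrightarrow> p (q x) = x"
proof -
  obtain e where "bij_betw e {0..<Suc k} \<sigma>"
    using ex_bij_betw_nat_finite[OF simplex_finite[OF simplex]] card by auto
  then have "bij_betw e {..k} \<sigma>"
    by (simp add: atLeast0LessThan lessThan_Suc_atMost)
  then interpret enumerated_simplex V S \<sigma> k e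
    using simplex by unfold_locales
  show thesis
    using continuous_on_disc_map disc_map_in_kdisc continuous_on_boundary_map
      boundary_map_in_boundary disc_map_in_ksphere boundary_map_disc_map
    by (intro that[of disc_map boundary_map] image_subsetI)
qed

section \<open>Adjacency of vertices\<close>

definition adj :: "'a set set \<Rightarrow> ('a \<times> 'a) set" where
  "adj S = {(v, w). {v, w} \<in> S}"

definition vertex_ball :: "'a set set \<Rightarrow> nat \<Rightarrow> 'a \<Rightarrow> 'a set" where
  "vertex_ball S n v = (adj S ^^ n) `` {v}"

definition degree_le :: "'a set \<Rightarrow> 'a set set \<Rightarrow> nat \<Rightarrow> bool" where
  "degree_le V S D \<longleftrightarrow>
     (\<forall>s\<in>V. finite {t. t \<noteq> s \<and> {s, t} \<in> S} \<and> card {t. t \<noteq> s \<and> {s, t} \<in> S} \<le> D)"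

lemma card_UN_le_mult:
  assumes "finite I" "\<And>i. i \<in> I \<Longrightarrow> card (A i) \<le> b"
  shows "card (\<Union>i\<in>I. A i) \<le> card I * b"
proof -
  have "card (\<Union>i\<in>I. A i) \<le> (\<Sum>i\<in>I. card (A i))"
    using assms(1) by (rule card_UN_le)
  also have "\<dots> \<le> card I * b"
    using sum_bounded_above[of I "\<lambda>i. card (A i)" b] assms(2) by simp
  finally show ?thesis .
qed

lemma adj_in_vertices:
  assumes "is_complex V S" "(v, w) \<in> adj S"
  shows "v \<in> V" "w \<in> V"
  using assms by (auto simp: adj_def is_complex_def)

lemma sym_adj: "sym (adj S)"
  by (simp add: sym_def adj_def insert_commute)

lemma simplex_adj:
  assumes "is_complex V S" "U \<in> S" "v \<in> U" "w \<in> U"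
  shows "(v, w) \<in> adj S"
  using simplex_subset[OF assms(1,2), of "{v, w}"] assms(3,4) by (simp add: adj_def)

lemma card_neighbours:
  assumes "degree_le V S D" "v \<in> V"
  shows "finite (adj S `` {v})" "card (adj S `` {v}) \<le> Suc D"
proof -
  have neighbours_subset: "adj S `` {v} \<subseteq> insert v {t. t \<noteq> v \<and> {v, t} \<in> S}" (is "_ \<subseteq> ?N")
    by (auto simp: adj_def)
  have card_N: "finite ?N" "card ?N \<le> Suc D"
    using assms by (auto simp: degree_le_def card_insert_if)
  show "finite (adj S `` {v})" using neighbours_subset card_N(1) by (rule finite_subset)
  show "card (adj S `` {v}) \<le> Suc D"
    using card_mono[OF card_N(1) neighbours_subset] card_N(2) by (rule order_trans)
qed

lemma card_simplex_le:
  assumes "is_complex V S" "degree_le V S D" "U \<in> S"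
  shows "card U \<le> Suc D"
proof (cases "U = {}")
  case False
  then obtain v where "v \<in> U" by blast
  then have "v \<in> V" using simplex_vertices[OF assms(1,3)] by blast
  note neighbours = card_neighbours[OF assms(2) this]
  have "U \<subseteq> adj S `` {v}"
    using simplex_adj[OF assms(1,3) \<open>v \<in> U\<close>] by blast
  then have "card U \<le> card (adj S `` {v})" by (rule card_mono[OF neighbours(1)])
  then show ?thesis using neighbours(2) by (rule order_trans)
qed simp

lemma vertex_ball_0 [simp]: "vertex_ball S 0 v = {v}"
  by (simp add: vertex_ball_def)

lemma vertex_ball_Suc: "vertex_ball S (Suc n) v = (\<Union>u\<in>vertex_ball S n v. adj S `` {u})"
  by (auto simp: vertex_ball_def)

lemma vertex_ball_sym: "w \<in> vertex_ball S n v \<Longrightarrow> v \<in> vertex_ball S n w"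
proof (induction n arbitrary: w)
  case (Suc n)
  then obtain u where "u \<in> vertex_ball S n v" "(u, w) \<in> adj S"
    by (auto simp: vertex_ball_Suc)
  then have "(u, v) \<in> adj S ^^ n" "(w, u) \<in> adj S"
    using Suc.IH symD[OF sym_adj] by (auto simp: vertex_ball_def)
  then have "(w, v) \<in> adj S ^^ Suc n" by (rule relpow_Suc_I2[rotated])
  then show ?case by (simp add: vertex_ball_def)
qed simp

lemma vertex_ball_mono:
  assumes complex: "is_complex V S" and "v \<in> V" "m \<le> n"
  shows "vertex_ball S m v \<subseteq> vertex_ball S n v"
proof (rule lift_Suc_mono_le[OF _ \<open>m \<le> n\<close>])
  fix n
  have "u \<in> adj S `` {u}" if "u \<in> vertex_ball S n v" for u
  proof -
    have "u \<in> V"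
      using that \<open>v \<in> V\<close> adj_in_vertices(2)[OF complex] by (cases n) (auto simp: vertex_ball_Suc)
    then show ?thesis using complex by (simp add: adj_def is_complex_def)
  qed
  then show "vertex_ball S n v \<subseteq> vertex_ball S (Suc n) v"
    unfolding vertex_ball_Suc by blast
qed

lemma vertex_ball_subset:
  assumes "is_complex V S" "v \<in> V"
  shows "vertex_ball S n v \<subseteq> V"
  using assms adj_in_vertices(2)[OF assms(1)] by (cases n) (auto simp: vertex_ball_Suc)

lemma card_vertex_ball:
  assumes complex: "is_complex V S" and degree: "degree_le V S D" and "v \<in> V"
  shows "finite (vertex_ball S n v)" "card (vertex_ball S n v) \<le> Suc D ^ n"
proof -
  have "finite (vertex_ball S n v) \<and> card (vertex_ball S n v) \<le> Suc D ^ n"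
  proof (induction n)
    case (Suc n)
    have ball_in_V: "u \<in> V" if "u \<in> vertex_ball S n v" for u
      using vertex_ball_subset[OF complex \<open>v \<in> V\<close>] that by blast
    have "card (vertex_ball S (Suc n) v) \<le> card (vertex_ball S n v) * Suc D"
      unfolding vertex_ball_Suc using Suc.IH card_neighbours(2)[OF degree ball_in_V]
      by (intro card_UN_le_mult) auto
    also have "\<dots> \<le> Suc D ^ n * Suc D"
      using Suc.IH by (intro mult_le_mono1) blast
    finally have "card (vertex_ball S (Suc n) v) \<le> Suc D ^ Suc n"
      by (simp add: mult.commute)
    moreover have "finite (vertex_ball S (Suc n) v)"
      unfolding vertex_ball_Suc using Suc.IH card_neighbours(1)[OF degree ball_in_V] by blast
    ultimately show ?case by blast
  qed simp
  then show "finite (vertex_ball S n v)" "card (vertex_ball S n v) \<le> Suc D ^ n" by auto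
qed

lemma edge_dist_le_iff_vertex_ball:
  assumes complex: "is_complex V S" and "v \<in> V"
  shows "edge_dist V S v w \<le> enat n \<longleftrightarrow> w \<in> vertex_ball S n v"
proof
  assume "edge_dist V S v w \<le> enat n"
  then have "edge_dist V S v w < enat (Suc n)"
    using le_less_trans by fastforce
  then obtain m p where m_less: "enat m < enat (Suc n)"
    and edge_path: "p 0 = v" "p m = w" "\<forall>i<m. {p i, p (Suc i)} \<in> S"
    unfolding edge_dist_def Inf_less_iff by blast
  then have "w \<in> vertex_ball S m v"
    unfolding vertex_ball_def Image_singleton_iff relpow_fun_conv
    by (intro exI[of _ p]) (simp add: adj_def)
  then show "w \<in> vertex_ball S n v"
    using vertex_ball_mono[OF assms, of m n] m_less by auto
next
  assume "w \<in> vertex_ball S n v"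
  then obtain p where edge_path: "p 0 = v" "p n = w" "\<forall>i<n. (p i, p (Suc i)) \<in> adj S"
    unfolding vertex_ball_def Image_singleton_iff relpow_fun_conv by blast
  have "p i \<in> V" if "i \<le> n" for i
  proof (cases i)
    case (Suc j)
    then show ?thesis using that edge_path(3) adj_in_vertices(2)[OF complex, of "p j" "p i"] by simp
  qed (use edge_path(1) \<open>v \<in> V\<close> in simp)
  then show "edge_dist V S v w \<le> enat n"
    unfolding edge_dist_def using edge_path by (intro Inf_lower) (auto simp: adj_def)
qed

lemma regular_map_adj_vertex_ball:
  assumes complex_X: "is_complex VX SX" and complex_Y: "is_complex VY SY"
    and regular: "regular_map VX SX VY SY \<phi>"
  obtains L where "\<And>v w. (v, w) \<in> adj SX \<Longrightarrow> \<phi> w \<in> vertex_ball SY L (\<phi> v)"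
proof -
  obtain L where lipschitz: "\<And>v w. \<lbrakk>v \<in> VX; w \<in> VX\<rbrakk>
      \<Longrightarrow> edge_dist VY SY (\<phi> v) (\<phi> w) \<le> enat L * edge_dist VX SX v w"
    using regular unfolding regular_map_def by blast
  have "\<phi> w \<in> vertex_ball SY L (\<phi> v)" if adjacent: "(v, w) \<in> adj SX" for v w
  proof -
    note vertices = adj_in_vertices[OF complex_X adjacent]
    have "edge_dist VX SX v w \<le> enat 1"
      using edge_dist_le_iff_vertex_ball[OF complex_X vertices(1), of w 1] adjacent
      by (simp add: vertex_ball_def)
    then have "enat L * edge_dist VX SX v w \<le> enat L * enat 1"
      by (intro mult_left_mono) auto
    then have "edge_dist VY SY (\<phi> v) (\<phi> w) \<le> enat L"
      using lipschitz[OF vertices] by simp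
    moreover have "\<phi> v \<in> VY"
      using regular vertices(1) by (auto simp: regular_map_def)
    ultimately show ?thesis
      using edge_dist_le_iff_vertex_ball[OF complex_Y] by blast
  qed
  then show thesis by (rule that)
qed

section \<open>Path metric and vertex distance\<close>

definition vertex_pt :: "'a \<Rightarrow> 'a \<Rightarrow> real" where
  "vertex_pt v = (\<lambda>w. if w = v then 1 else 0)"

definition oscillation_le :: "'a set set \<Rightarrow> ('a \<Rightarrow> real) \<Rightarrow> real \<Rightarrow> bool" where
  "oscillation_le S \<rho> r \<longleftrightarrow> (\<forall>U\<in>S. \<forall>a\<in>U. \<forall>b\<in>U. \<bar>\<rho> a - \<rho> b\<bar> \<le> r)"

definition affine_extension :: "('a \<Rightarrow> real) \<Rightarrow> ('a \<Rightarrow> real) \<Rightarrow> real" where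
  "affine_extension \<rho> f = (\<Sum>u\<in>supp f. \<rho> u * f u)"

definition truncated_dist :: "'a set set \<Rightarrow> nat \<Rightarrow> 'a \<Rightarrow> 'a \<Rightarrow> nat" where
  "truncated_dist S N v w = (LEAST n. w \<in> vertex_ball S n v \<or> N \<le> n)"

lemma supp_vertex_pt [simp]: "supp (vertex_pt v) = {v}"
  by (auto simp: supp_def vertex_pt_def)

lemma inj_vertex_pt: "inj vertex_pt"
  by (metis injI singleton_inject supp_vertex_pt)

lemma vertex_pt_realis: "is_complex V S \<Longrightarrow> v \<in> V \<Longrightarrow> vertex_pt v \<in> realis V S"
  by (auto simp: realis_def is_complex_def) (auto simp: vertex_pt_def)

lemma vertex_pt_closed_simplex:
  assumes "is_complex V S" "\<sigma> \<in> S" "v \<in> \<sigma>"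
  shows "vertex_pt v \<in> closed_simplex V S \<sigma>"
  using vertex_pt_realis[OF assms(1)] simplex_vertices[OF assms(1,2)] assms(3)
  by (auto simp: closed_simplex_def)

lemma cdist_vertex_pt_adj:
  assumes complex: "is_complex V S" and adjacent: "(v, w) \<in> adj S"
  shows "cdist V S (vertex_pt v) (vertex_pt w) \<le> ereal 2"
proof -
  have "l2dist (vertex_pt v) (vertex_pt w) \<le> (\<Sum>x\<in>{v, w}. \<bar>vertex_pt v x - vertex_pt w x\<bar>)"
    by (intro l2dist_le_sum_abs) auto
  also have "\<dots> \<le> 2"
    by (cases "v = w") (auto simp: vertex_pt_def)
  finally have "ereal (l2dist (vertex_pt v) (vertex_pt w)) \<le> ereal 2" by simp
  moreover have "cdist V S (vertex_pt v) (vertex_pt w) \<le> ereal (l2dist (vertex_pt v) (vertex_pt w))"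
    using adjacent vertex_pt_realis[OF complex] adj_in_vertices[OF complex adjacent]
    by (intro cdist_le_l2dist) (simp_all add: adj_def insert_commute)
  ultimately show ?thesis by (rule order_trans[rotated])
qed

lemma cdist_vertex_pt_le:
  assumes complex: "is_complex V S" and "v \<in> V" and "w \<in> vertex_ball S n v"
  shows "cdist V S (vertex_pt v) (vertex_pt w) \<le> ereal (2 * real n)"
  using assms(3)
proof (induction n arbitrary: w)
  case 0
  then show ?case using cdist_self[OF vertex_pt_realis[OF complex \<open>v \<in> V\<close>]] by simp
next
  case (Suc n)
  then obtain u where last_step: "u \<in> vertex_ball S n v" "(u, w) \<in> adj S"
    by (auto simp: vertex_ball_Suc)
  have "cdist V S (vertex_pt v) (vertex_pt w)
      \<le> cdist V S (vertex_pt v) (vertex_pt u) + cdist V S (vertex_pt u) (vertex_pt w)"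
    by (rule cdist_triangle)
  also have "\<dots> \<le> ereal (2 * real n) + ereal 2"
    by (intro add_mono Suc.IH last_step(1) cdist_vertex_pt_adj[OF complex last_step(2)])
  finally show ?case by (simp add: add.commute)
qed

lemma affine_extension_superset:
  assumes "finite A" "supp f \<subseteq> A"
  shows "affine_extension \<rho> f = (\<Sum>u\<in>A. \<rho> u * f u)"
  unfolding affine_extension_def using assms by (intro sum.mono_neutral_left) (auto simp: supp_def)

lemma abs_affine_extension_diff_le:
  assumes "oscillation_le S \<rho> r" and x_in: "x \<in> realis V S" and "v \<in> supp x"
  shows "\<bar>affine_extension \<rho> x - \<rho> v\<bar> \<le> r"
proof -
  have "\<bar>\<rho> u - \<rho> v\<bar> \<le> r" if "u \<in> supp x" for u
    using assms that realis_supp[OF x_in] by (simp add: oscillation_le_def)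
  then show ?thesis
    unfolding affine_extension_def using x_in by (intro convex_sum_bound_le) (auto simp: realis_def)
qed

lemma affine_extension_lipschitz:
  assumes complex: "is_complex V S" and card_le: "\<And>U. U \<in> S \<Longrightarrow> card U \<le> m"
    and oscillation: "oscillation_le S \<rho> r" and "0 \<le> r"
    and f_in: "f \<in> realis V S" and g_in: "g \<in> realis V S" and union_simplex: "supp f \<union> supp g \<in> S"
  shows "\<bar>affine_extension \<rho> f - affine_extension \<rho> g\<bar> \<le> real m * r * l2dist f g"
proof -
  let ?A = "supp f \<union> supp g"
  have finite_union: "finite ?A" using simplex_finite[OF complex union_simplex] .
  obtain a where a_in: "a \<in> ?A" using realis_supp_nonempty[OF f_in] by blast
  have "sum f ?A = 1" "sum g ?A = 1"
    using realis_sum_superset[OF f_in finite_union] realis_sum_superset[OF g_in finite_union]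
    by auto
  then have "(\<Sum>u\<in>?A. \<rho> a * (f u - g u)) = 0"
    by (simp add: sum_distrib_left[symmetric] sum_subtractf)
  moreover have "affine_extension \<rho> f - affine_extension \<rho> g = (\<Sum>u\<in>?A. \<rho> u * (f u - g u))"
    using affine_extension_superset[OF finite_union, of f]
      affine_extension_superset[OF finite_union, of g]
    by (simp add: sum_subtractf right_diff_distrib)
  ultimately have "affine_extension \<rho> f - affine_extension \<rho> g = (\<Sum>u\<in>?A. (\<rho> u - \<rho> a) * (f u - g u))"
    by (simp add: sum_subtractf left_diff_distrib)
  also have "\<bar>\<dots>\<bar> \<le> (\<Sum>u\<in>?A. r * l2dist f g)"
  proof (rule order_trans[OF sum_abs sum_mono])
    fix u assume "u \<in> ?A"
    then have "\<bar>\<rho> u - \<rho> a\<bar> \<le> r"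
      using oscillation union_simplex a_in by (simp add: oscillation_le_def)
    then show "\<bar>(\<rho> u - \<rho> a) * (f u - g u)\<bar> \<le> r * l2dist f g"
      unfolding abs_mult using abs_diff_le_l2dist[OF finite_union] \<open>0 \<le> r\<close> by (intro mult_mono) auto
  qed
  also have "\<dots> \<le> real m * (r * l2dist f g)"
    using card_le[OF union_simplex] \<open>0 \<le> r\<close> by (simp add: mult_right_mono l2dist_nonneg)
  finally show ?thesis by (simp add: mult.assoc)
qed

lemma truncated_dist_self: "truncated_dist S N v v = 0"
  unfolding truncated_dist_def by (intro Least_eq_0) simp

lemma truncated_dist_cases:
  "w \<in> vertex_ball S (truncated_dist S N v w) v \<or> N \<le> truncated_dist S N v w"
  unfolding truncated_dist_def by (rule LeastI_ex) blast

lemma truncated_dist_adj: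
  assumes "(a, b) \<in> adj S"
  shows "truncated_dist S N v b \<le> Suc (truncated_dist S N v a)"
proof -
  let ?n = "truncated_dist S N v a"
  have "b \<in> vertex_ball S (Suc ?n) v \<or> N \<le> Suc ?n"
    using truncated_dist_cases[of a S N v] assms by (auto simp: vertex_ball_Suc)
  then show ?thesis
    unfolding truncated_dist_def[of S N v b] by (rule Least_le)
qed

lemma oscillation_truncated_dist:
  assumes "is_complex V S"
  shows "oscillation_le S (\<lambda>w. real (truncated_dist S N v w)) 1"
proof -
  have "\<bar>real (truncated_dist S N v a) - real (truncated_dist S N v b)\<bar> \<le> 1"
    if "U \<in> S" "a \<in> U" "b \<in> U" for U a b
    using truncated_dist_adj[OF simplex_adj[OF assms that], of N v]
      truncated_dist_adj[OF simplex_adj[OF assms that(1,3,2)], of N v] by linarith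
  then show ?thesis by (simp add: oscillation_le_def)
qed

text \<open>The vertex distance to \<open>v\<close>, truncated to stay finite, varies by at most 1 on each simplex.
  Its affine extension is therefore Lipschitz for the path metric.\<close>

lemma supp_subset_vertex_ball:
  assumes complex: "is_complex V S" and card_le: "\<And>U. U \<in> S \<Longrightarrow> card U \<le> m" and "0 < m"
    and x_in: "x \<in> realis V S" and y_in: "y \<in> realis V S" and cdist_le: "cdist V S x y \<le> ereal t"
    and v_in: "v \<in> supp x" and N_large: "2 + real m * t < real N"
  shows "supp y \<subseteq> vertex_ball S N v"
proof
  fix w assume w_in: "w \<in> supp y"
  define \<rho> where "\<rho> = (\<lambda>w. real (truncated_dist S N v w))"
  have oscillation: "oscillation_le S \<rho> 1"
    unfolding \<rho>_def using complex by (rule oscillation_truncated_dist)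
  have "ereal (dist (affine_extension \<rho> x) (affine_extension \<rho> y) / real m) \<le> cdist V S x y"
    using affine_extension_lipschitz[OF complex card_le oscillation] \<open>0 < m\<close>
    by (intro lipschitz_le_cdist) (simp_all add: dist_real_def)
  then have "ereal (dist (affine_extension \<rho> x) (affine_extension \<rho> y) / real m) \<le> ereal t"
    using cdist_le by (rule order_trans)
  then have "\<bar>affine_extension \<rho> x - affine_extension \<rho> y\<bar> \<le> real m * t"
    using \<open>0 < m\<close> by (simp add: dist_real_def field_simps)
  moreover have "\<bar>affine_extension \<rho> x - \<rho> v\<bar> \<le> 1" "\<bar>affine_extension \<rho> y - \<rho> w\<bar> \<le> 1"
    using abs_affine_extension_diff_le[OF oscillation] x_in y_in v_in w_in by blast+
  moreover have "\<rho> v = 0" by (simp add: \<rho>_def truncated_dist_self)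
  ultimately have "\<rho> w < real N" using N_large by linarith
  then have less: "truncated_dist S N v w < N" by (simp add: \<rho>_def)
  then have "w \<in> vertex_ball S (truncated_dist S N v w) v"
    using truncated_dist_cases[of w S N v] by simp
  moreover have "v \<in> V"
    using simplex_vertices[OF complex realis_supp[OF x_in]] v_in by blast
  ultimately show "w \<in> vertex_ball S N v"
    using vertex_ball_mono[OF complex] less by (meson less_imp_le subsetD)
qed

section \<open>Filling skeleta\<close>

definition controlled_on ::
    "'b set \<Rightarrow> 'b set set \<Rightarrow> real \<Rightarrow> 'c set \<Rightarrow> ('c::topological_space \<Rightarrow> 'b \<Rightarrow> real) \<Rightarrow> bool" where
  "controlled_on V S T A F \<longleftrightarrow> continuous_on A F \<and> F ` A \<subseteq> realis V S \<and> diam_le V S (F ` A) T"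

definition controlled_filling :: "'a set \<Rightarrow> 'a set set \<Rightarrow> 'a set \<Rightarrow> 'b set \<Rightarrow> 'b set set \<Rightarrow> real
    \<Rightarrow> (('a \<Rightarrow> real) \<Rightarrow> 'b \<Rightarrow> real) \<Rightarrow> (('a \<Rightarrow> real) \<Rightarrow> 'b \<Rightarrow> real) \<Rightarrow> bool" where
  "controlled_filling VX SX \<sigma> VY SY T F G \<longleftrightarrow>
     controlled_on VY SY T (closed_simplex VX SX \<sigma>) G \<and> (\<forall>x\<in>simplex_boundary VX SX \<sigma>. G x = F x)"

definition skeleton :: "'a set set \<Rightarrow> nat \<Rightarrow> 'a set set" where
  "skeleton S n = {\<sigma> \<in> S. card \<sigma> \<le> Suc n}"

definition glue_top_simplices ::
    "nat \<Rightarrow> ('a set \<Rightarrow> ('a \<Rightarrow> real) \<Rightarrow> 'c) \<Rightarrow> (('a \<Rightarrow> real) \<Rightarrow> 'c) \<Rightarrow> ('a \<Rightarrow> real) \<Rightarrow> 'c" where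
  "glue_top_simplices m G \<Phi> = (\<lambda>x. if card (supp x) = m then G (supp x) x else \<Phi> x)"

lemma diam_le_subset: "diam_le V S B s \<Longrightarrow> A \<subseteq> B \<Longrightarrow> diam_le V S A s"
  unfolding diam_le_def by blast

lemma controlled_on_compose:
  assumes "controlled_on V S T B F" "continuous_on A p" "p ` A \<subseteq> B"
  shows "controlled_on V S T A (F \<circ> p)"
proof -
  have "continuous_on A (F \<circ> p)"
    using assms unfolding controlled_on_def by (meson continuous_on_compose continuous_on_subset)
  moreover have "(F \<circ> p) ` A \<subseteq> F ` B" using assms(3) by auto
  ultimately show ?thesis
    using assms(1) unfolding controlled_on_def by (metis diam_le_subset subset_trans)
qed

lemma controlled_on_cong:
  assumes "\<And>x. x \<in> A \<Longrightarrow> F x = G x"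
  shows "controlled_on V S T A F \<longleftrightarrow> controlled_on V S T A G"
proof -
  have "F ` A = G ` A" using assms by simp
  moreover have "continuous_on A F \<longleftrightarrow> continuous_on A G"
    using assms by (intro continuous_on_cong) simp_all
  ultimately show ?thesis by (simp add: controlled_on_def)
qed

lemma controlled_on_mono:
  assumes "controlled_on V S T A F" "T \<le> T'"
  shows "controlled_on V S T' A F"
proof -
  have "ereal T \<le> ereal T'" using assms(2) by simp
  then show ?thesis
    using assms(1) unfolding controlled_on_def diam_le_def by (meson order_trans)
qed

lemma controlled_on_cdist_le:
  "controlled_on V S T A F \<Longrightarrow> x \<in> A \<Longrightarrow> y \<in> A \<Longrightarrow> cdist V S (F x) (F y) \<le> ereal T"
  by (simp add: controlled_on_def diam_le_def)

lemma metric_cont_diam_le_iff_controlled_on: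
  assumes "is_complex V S" "A \<subseteq> {x. \<forall>i\<ge>k. x i = 0}"
  shows "metric_cont V S k A f \<and> diam_le V S (f ` A) s \<longleftrightarrow> controlled_on V S s A f"
  using metric_cont_iff_continuous_on[OF assms(1) _ assms(2)]
  by (auto simp: controlled_on_def metric_cont_def)

lemma unif_connected_filling:
  assumes complex: "is_complex V S" and connected: "unif_connected V S k"
  obtains T where "\<And>f. controlled_on V S s (ksphere k) f
    \<Longrightarrow> \<exists>g. controlled_on V S T (kdisc k) g \<and> (\<forall>x\<in>ksphere k. g x = f x)"
proof -
  have "ksphere k \<subseteq> {x. \<forall>i\<ge>k. x i = 0}" "kdisc k \<subseteq> {x. \<forall>i\<ge>k. x i = 0}"
    by (auto simp: ksphere_def kdisc_def)
  note controlled = this[THEN metric_cont_diam_le_iff_controlled_on[OF complex]]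
  have "\<exists>T. \<forall>f. controlled_on V S s (ksphere k) f \<longrightarrow>
      (\<exists>g. controlled_on V S T (kdisc k) g \<and> (\<forall>x\<in>ksphere k. g x = f x))"
    using connected[unfolded unif_connected_def, rule_format, of s] unfolding controlled[symmetric]
    by (simp add: conj_ac)
  then show thesis using that by blast
qed

lemma unif_connected_simplex_filling:
  fixes W :: "'a set"
  assumes complex_W: "is_complex W R" and complex: "is_complex V S"
    and connected: "unif_connected V S k"
  obtains T where "\<And>\<sigma> F. \<lbrakk>\<sigma> \<in> R; card \<sigma> = Suc k;
      controlled_on V S s (simplex_boundary W R \<sigma>) F\<rbrakk>
    \<Longrightarrow> \<exists>G. controlled_filling W R \<sigma> V S T F G"
proof -
  obtain T where fill: "\<And>f. controlled_on V S s (ksphere k) f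
      \<Longrightarrow> \<exists>g. controlled_on V S T (kdisc k) g \<and> (\<forall>x\<in>ksphere k. g x = f x)"
    using unif_connected_filling[OF complex connected] by blast
  show thesis
  proof (rule that)
    fix \<sigma> and F :: "('a \<Rightarrow> real) \<Rightarrow> 'b \<Rightarrow> real"
    assume simplex: "\<sigma> \<in> R" "card \<sigma> = Suc k"
      and F_controlled: "controlled_on V S s (simplex_boundary W R \<sigma>) F"
    obtain q p where
      to_disc: "continuous_on (closed_simplex W R \<sigma>) q" "q ` closed_simplex W R \<sigma> \<subseteq> kdisc k" and
      from_sphere: "continuous_on (ksphere k) p" "p ` ksphere k \<subseteq> simplex_boundary W R \<sigma>" and
      inverse_on_boundary: "q ` simplex_boundary W R \<sigma> \<subseteq> ksphere k"
        "\<And>x. x \<in> simplex_boundary W R \<sigma> \<Longrightarrow> p (q x) = x"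
      using simplex_disc_maps[OF complex_W simplex] by blast
    obtain g where filling: "controlled_on V S T (kdisc k) g" "\<And>x. x \<in> ksphere k \<Longrightarrow> g x = F (p x)"
      using fill[OF controlled_on_compose[OF F_controlled from_sphere]] by auto
    have "controlled_on V S T (closed_simplex W R \<sigma>) (g \<circ> q)"
      using filling(1) to_disc by (rule controlled_on_compose)
    moreover have "\<forall>x\<in>simplex_boundary W R \<sigma>. (g \<circ> q) x = F x"
      using filling(2) inverse_on_boundary by (simp add: image_subset_iff)
    ultimately show "\<exists>G. controlled_filling W R \<sigma> V S T F G"
      unfolding controlled_filling_def by blast
  qed
qed

lemma simplex_boundary_eq_Union:
  "simplex_boundary V S \<sigma> = (\<Union>v\<in>\<sigma>. closed_simplex V S (\<sigma> - {v}))"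
proof -
  have "supp x \<subseteq> \<sigma> \<and> supp x \<noteq> \<sigma> \<longleftrightarrow> (\<exists>v\<in>\<sigma>. supp x \<subseteq> \<sigma> - {v})" for x :: "'a \<Rightarrow> real"
    by blast
  then show ?thesis unfolding simplex_boundary_def closed_simplex_def by blast
qed

lemma controlled_on_near_vertex:
  assumes complex: "is_complex VX SX" "\<tau> \<in> SX"
    and controlled: "controlled_on VY SY T (closed_simplex VX SX \<tau>) \<Phi>"
    and x_in: "x \<in> closed_simplex VX SX \<tau>"
  obtains v where "v \<in> \<tau>" "cdist VY SY (\<Phi> x) (\<Phi> (vertex_pt v)) \<le> ereal T"
proof -
  obtain v where "v \<in> supp x"
    using realis_supp_nonempty[OF closed_simplex_realis[OF x_in]] by blast
  then have "v \<in> \<tau>" using closed_simplex_supp[OF x_in] by blast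
  moreover from this have "cdist VY SY (\<Phi> x) (\<Phi> (vertex_pt v)) \<le> ereal T"
    by (intro controlled_on_cdist_le[OF controlled x_in] vertex_pt_closed_simplex[OF complex])
  ultimately show thesis by (rule that)
qed

lemma diam_le_near_vertices:
  assumes near: "\<And>x. x \<in> B \<Longrightarrow> \<exists>v\<in>\<sigma>. cdist V S x (p v) \<le> ereal T"
    and vertices: "\<And>v w. \<lbrakk>v \<in> \<sigma>; w \<in> \<sigma>\<rbrakk> \<Longrightarrow> cdist V S (p v) (p w) \<le> ereal L"
  shows "diam_le V S B (T + (L + T))"
  unfolding diam_le_def
proof (intro ballI)
  fix x y assume "x \<in> B" "y \<in> B"
  then obtain v w where vw_in: "v \<in> \<sigma>" "w \<in> \<sigma>"
    and x_near: "cdist V S x (p v) \<le> ereal T" and y_near: "cdist V S (p w) y \<le> ereal T"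
    using near cdist_commute[of V S] by metis
  have "cdist V S (p v) y \<le> ereal L + ereal T"
    by (rule order_trans[OF cdist_triangle add_mono[OF vertices[OF vw_in] y_near]])
  then have "cdist V S x y \<le> ereal T + (ereal L + ereal T)"
    by (rule order_trans[OF cdist_triangle add_mono[OF x_near]])
  then show "cdist V S x y \<le> ereal (T + (L + T))" by simp
qed

lemma controlled_on_boundary:
  assumes complex_X: "is_complex VX SX" and simplex: "\<sigma> \<in> SX"
    and faces: "\<And>\<tau>. \<lbrakk>\<tau> \<in> SX; \<tau> \<subset> \<sigma>\<rbrakk> \<Longrightarrow> controlled_on VY SY T (closed_simplex VX SX \<tau>) \<Phi>"
    and vertices: "\<And>v w. \<lbrakk>v \<in> \<sigma>; w \<in> \<sigma>\<rbrakk>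
      \<Longrightarrow> cdist VY SY (\<Phi> (vertex_pt v)) (\<Phi> (vertex_pt w)) \<le> ereal L"
  shows "controlled_on VY SY (T + (L + T)) (simplex_boundary VX SX \<sigma>) \<Phi>"
proof -
  let ?B = "simplex_boundary VX SX \<sigma>"
  have face: "\<sigma> - {v} \<in> SX" for v
    using simplex_subset[OF complex_X simplex] by blast
  have controlled: "controlled_on VY SY T (closed_simplex VX SX (\<sigma> - {v})) \<Phi>" if "v \<in> \<sigma>" for v
    using faces[OF face] that by blast
  have "continuous_on ?B \<Phi>"
    unfolding simplex_boundary_eq_Union
    using simplex_finite[OF complex_X simplex] closed_closed_simplex[OF complex_X face] controlled
    by (intro continuous_on_closed_Union) (auto simp: controlled_on_def)
  moreover have "\<Phi> ` ?B \<subseteq> realis VY SY"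
    unfolding simplex_boundary_eq_Union using controlled by (auto simp: controlled_on_def)
  moreover have "\<exists>v\<in>\<sigma>. cdist VY SY y (\<Phi> (vertex_pt v)) \<le> ereal T" if "y \<in> \<Phi> ` ?B" for y
  proof -
    obtain a x where "a \<in> \<sigma>" "x \<in> closed_simplex VX SX (\<sigma> - {a})" "y = \<Phi> x"
      using \<open>y \<in> \<Phi> ` ?B\<close> unfolding simplex_boundary_eq_Union by blast
    then show ?thesis
      using controlled_on_near_vertex[OF complex_X face controlled] by blast
  qed
  then have "diam_le VY SY (\<Phi> ` ?B) (T + (L + T))"
    using vertices by (rule diam_le_near_vertices)
  ultimately show ?thesis by (simp add: controlled_on_def)
qed

lemma closed_simplex_singleton:
  assumes "x \<in> closed_simplex V S {v}"
  shows "x = vertex_pt v"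
proof
  have supp_subset: "supp x \<subseteq> {v}" using closed_simplex_supp[OF assms] .
  then have "x v = 1"
    using realis_sum_superset[OF closed_simplex_realis[OF assms] _ supp_subset] by simp
  then show "x w = vertex_pt v w" for w using supp_subset by (auto simp: vertex_pt_def supp_def)
qed

lemma vertex_extension:
  assumes complex_X: "is_complex VX SX" and complex_Y: "is_complex VY SY"
    and vertex_map: "\<phi> ` VX \<subseteq> VY"
  obtains \<Phi> where "\<And>v. \<Phi> (vertex_pt v) = vertex_pt (\<phi> v)"
    "\<And>\<sigma>. \<sigma> \<in> skeleton SX 0 \<Longrightarrow> controlled_on VY SY 0 (closed_simplex VX SX \<sigma>) \<Phi>"
proof
  define \<Phi> where "\<Phi> = (\<lambda>x. vertex_pt (\<phi> (inv vertex_pt x)))"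
  show extends: "\<Phi> (vertex_pt v) = vertex_pt (\<phi> v)" for v
    by (simp add: \<Phi>_def inv_f_f[OF inj_vertex_pt])
  fix \<sigma> assume "\<sigma> \<in> skeleton SX 0"
  then have simplex: "\<sigma> \<in> SX" "card \<sigma> \<le> 1" by (simp_all add: skeleton_def)
  show "controlled_on VY SY 0 (closed_simplex VX SX \<sigma>) \<Phi>"
  proof (cases "\<sigma> = {}")
    case True
    then have "closed_simplex VX SX \<sigma> = {}"
      using realis_supp_nonempty by (fastforce simp: closed_simplex_def)
    then show ?thesis by (simp add: controlled_on_def diam_le_def)
  next
    case False
    then have "card \<sigma> = 1"
      using simplex(2) simplex_finite[OF complex_X simplex(1)] by (simp add: le_Suc_eq)
    then obtain v where singleton: "\<sigma> = {v}" by (rule card_1_singletonE)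
    then have "vertex_pt (\<phi> v) \<in> realis VY SY"
      using simplex_vertices[OF complex_X simplex(1)] vertex_map
      by (auto intro: vertex_pt_realis[OF complex_Y])
    moreover have "\<Phi> x = vertex_pt (\<phi> v)" if "x \<in> closed_simplex VX SX \<sigma>" for x
      using closed_simplex_singleton[of x VX SX v] that singleton extends by simp
    ultimately show ?thesis
      by (subst controlled_on_cong) (auto simp: controlled_on_def diam_le_def cdist_self)
  qed
qed

lemma glue_top_simplices_eq_lower:
  assumes "finite \<sigma>" "card \<sigma> < m" and x_in: "x \<in> closed_simplex V S \<sigma>"
  shows "glue_top_simplices m G \<Phi> x = \<Phi> x"
  using card_mono[OF assms(1) closed_simplex_supp[OF x_in]] assms(2)
  by (simp add: glue_top_simplices_def)

lemma glue_top_simplices_eq_top: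
  assumes "finite \<sigma>" "card \<sigma> = m" and agree: "\<And>x. x \<in> simplex_boundary V S \<sigma> \<Longrightarrow> G \<sigma> x = \<Phi> x"
    and x_in: "x \<in> closed_simplex V S \<sigma>"
  shows "glue_top_simplices m G \<Phi> x = G \<sigma> x"
proof (cases "supp x = \<sigma>")
  case False
  then have "card (supp x) < m"
    using psubset_card_mono[OF assms(1), of "supp x"] closed_simplex_supp[OF x_in] assms(2) by auto
  then show ?thesis
    using agree x_in False by (simp add: glue_top_simplices_def simplex_boundary_def)
qed (simp add: glue_top_simplices_def assms(2))

lemma skeleton_glueing:
  assumes complex: "is_complex VX SX"
    and controlled: "\<And>\<sigma>. \<sigma> \<in> skeleton SX n \<Longrightarrow> controlled_on VY SY T (closed_simplex VX SX \<sigma>) \<Phi>"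
    and fill: "\<And>\<sigma>. \<lbrakk>\<sigma> \<in> SX; card \<sigma> = Suc (Suc n)\<rbrakk>
      \<Longrightarrow> controlled_filling VX SX \<sigma> VY SY T' \<Phi> (G \<sigma>)"
    and "\<sigma> \<in> skeleton SX (Suc n)"
  shows "controlled_on VY SY (max T T') (closed_simplex VX SX \<sigma>)
      (glue_top_simplices (Suc (Suc n)) G \<Phi>)" (is "controlled_on _ _ _ _ ?\<Psi>")
proof -
  have simplex: "\<sigma> \<in> SX" "card \<sigma> \<le> Suc (Suc n)"
    using assms(4) by (simp_all add: skeleton_def)
  note finite_simplex = simplex_finite[OF complex simplex(1)]
  show ?thesis
  proof (cases "card \<sigma> = Suc (Suc n)")
    case True
    note filling = fill[OF simplex(1) True, unfolded controlled_filling_def]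
    have "?\<Psi> x = G \<sigma> x" if "x \<in> closed_simplex VX SX \<sigma>" for x
      using filling that by (intro glue_top_simplices_eq_top[OF finite_simplex True]) auto
    then have "controlled_on VY SY T' (closed_simplex VX SX \<sigma>) ?\<Psi>"
      using filling by (subst controlled_on_cong) auto
    then show ?thesis by (rule controlled_on_mono) simp
  next
    case False
    then have card: "card \<sigma> < Suc (Suc n)" using simplex(2) by simp
    then have "\<sigma> \<in> skeleton SX n" using simplex(1) by (simp add: skeleton_def)
    moreover have "?\<Psi> x = \<Phi> x" if "x \<in> closed_simplex VX SX \<sigma>" for x
      using finite_simplex card that by (rule glue_top_simplices_eq_lower)
    ultimately have "controlled_on VY SY T (closed_simplex VX SX \<sigma>) ?\<Psi>"
      using controlled by (subst controlled_on_cong) auto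
    then show ?thesis by (rule controlled_on_mono) simp
  qed
qed

lemma skeleton_extension_Suc:
  fixes \<Phi> :: "('a \<Rightarrow> real) \<Rightarrow> 'b \<Rightarrow> real"
  assumes complex_X: "is_complex VX SX" and complex_Y: "is_complex VY SY"
    and connected: "unif_connected VY SY (Suc n)"
    and controlled: "\<And>\<sigma>. \<sigma> \<in> skeleton SX n \<Longrightarrow> controlled_on VY SY T (closed_simplex VX SX \<sigma>) \<Phi>"
    and edge: "\<And>v w. (v, w) \<in> adj SX
      \<Longrightarrow> cdist VY SY (\<Phi> (vertex_pt v)) (\<Phi> (vertex_pt w)) \<le> ereal L"
  obtains \<Psi> T' where "\<And>v. \<Psi> (vertex_pt v) = \<Phi> (vertex_pt v)"
    "\<And>\<sigma>. \<sigma> \<in> skeleton SX (Suc n) \<Longrightarrow> controlled_on VY SY T' (closed_simplex VX SX \<sigma>) \<Psi>"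
proof -
  obtain T' where fill: "\<And>\<sigma> F. \<lbrakk>\<sigma> \<in> SX; card \<sigma> = Suc (Suc n);
      controlled_on VY SY (T + (L + T)) (simplex_boundary VX SX \<sigma>) F\<rbrakk>
    \<Longrightarrow> \<exists>G. controlled_filling VX SX \<sigma> VY SY T' F G"
    by (rule unif_connected_simplex_filling[OF complex_X complex_Y connected]) blast
  have boundary: "controlled_on VY SY (T + (L + T)) (simplex_boundary VX SX \<sigma>) \<Phi>"
    if simplex: "\<sigma> \<in> SX" "card \<sigma> = Suc (Suc n)" for \<sigma>
  proof (rule controlled_on_boundary[OF complex_X simplex(1)])
    fix \<tau> assume face: "\<tau> \<in> SX" "\<tau> \<subset> \<sigma>"
    then have "card \<tau> < Suc (Suc n)"
      using psubset_card_mono[OF simplex_finite[OF complex_X simplex(1)]] simplex(2) by metis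
    then show "controlled_on VY SY T (closed_simplex VX SX \<tau>) \<Phi>"
      using controlled face(1) by (simp add: skeleton_def)
  qed (use edge simplex_adj[OF complex_X simplex(1)] in blast)
  obtain G where "\<And>\<sigma>. \<lbrakk>\<sigma> \<in> SX; card \<sigma> = Suc (Suc n)\<rbrakk>
      \<Longrightarrow> controlled_filling VX SX \<sigma> VY SY T' \<Phi> (G \<sigma>)"
    using fill[OF _ _ boundary] by metis
  note glued = skeleton_glueing[OF complex_X controlled this]
  show thesis
    by (rule that[OF _ glued]) (simp_all add: glue_top_simplices_def)
qed

lemma skeleton_extension:
  assumes complex_X: "is_complex VX SX" and complex_Y: "is_complex VY SY"
    and connected: "\<forall>k. 1 \<le> k \<and> k \<le> n \<longrightarrow> unif_connected VY SY k"
    and vertex_map: "\<phi> ` VX \<subseteq> VY"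
    and edge: "\<forall>(v, w)\<in>adj SX. cdist VY SY (vertex_pt (\<phi> v)) (vertex_pt (\<phi> w)) \<le> ereal L"
  shows "\<exists>\<Phi> T. (\<forall>v. \<Phi> (vertex_pt v) = vertex_pt (\<phi> v)) \<and>
    (\<forall>\<sigma>\<in>skeleton SX n. controlled_on VY SY T (closed_simplex VX SX \<sigma>) \<Phi>)"
  using connected
proof (induction n)
  case 0
  show ?case
    by (rule vertex_extension[OF complex_X complex_Y vertex_map]) blast
next
  case (Suc n)
  then obtain \<Phi> T where extends: "\<And>v. \<Phi> (vertex_pt v) = vertex_pt (\<phi> v)"
    and controlled: "\<And>\<sigma>. \<sigma> \<in> skeleton SX n \<Longrightarrow> controlled_on VY SY T (closed_simplex VX SX \<sigma>) \<Phi>"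
    by (metis le_SucI)
  have "unif_connected VY SY (Suc n)" using Suc.prems by simp
  moreover have "cdist VY SY (\<Phi> (vertex_pt v)) (\<Phi> (vertex_pt w)) \<le> ereal L"
    if "(v, w) \<in> adj SX" for v w
    using edge that by (auto simp: extends)
  ultimately obtain \<Psi> T' where "\<And>v. \<Psi> (vertex_pt v) = \<Phi> (vertex_pt v)"
    "\<And>\<sigma>. \<sigma> \<in> skeleton SX (Suc n) \<Longrightarrow> controlled_on VY SY T' (closed_simplex VX SX \<sigma>) \<Psi>"
    using skeleton_extension_Suc[OF complex_X complex_Y _ controlled] by blast
  then show ?case by (metis extends)
qed

section \<open>Continuous maps that follow a vertex map\<close>

definition follows_vertex_map :: "'a set \<Rightarrow> 'a set set \<Rightarrow> 'b set \<Rightarrow> 'b set set \<Rightarrow> ('a \<Rightarrow> 'b) \<Rightarrow> nat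
    \<Rightarrow> (('a \<Rightarrow> real) \<Rightarrow> 'b \<Rightarrow> real) \<Rightarrow> bool" where
  "follows_vertex_map VX SX VY SY \<phi> N \<Phi> \<longleftrightarrow> (\<forall>\<sigma>\<in>SX. continuous_on (closed_simplex VX SX \<sigma>) \<Phi> \<and>
     \<Phi> ` closed_simplex VX SX \<sigma> \<subseteq> realis VY SY \<and>
     (\<forall>v\<in>\<sigma>. \<forall>x\<in>closed_simplex VX SX \<sigma>. supp (\<Phi> x) \<subseteq> vertex_ball SY N (\<phi> v)))"

definition push :: "'a set \<Rightarrow> ('a \<Rightarrow> 'b) \<Rightarrow> ('a \<Rightarrow> real) \<Rightarrow> 'b \<Rightarrow> real" where
  "push V g f = (\<lambda>w. if w \<in> g ` V then f (inv_into V g w) else 0)"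

lemma regular_map_extension:
  assumes complex_X: "is_complex VX SX" and complex_Y: "is_complex VY SY"
    and degree: "degree_le VY SY D"
    and card_le: "\<And>\<sigma>. \<sigma> \<in> SX \<Longrightarrow> card \<sigma> \<le> Suc d"
    and connected: "\<forall>k. 1 \<le> k \<and> k \<le> d \<longrightarrow> unif_connected VY SY k"
    and regular: "regular_map VX SX VY SY \<phi>"
  obtains \<Phi> N where "follows_vertex_map VX SX VY SY \<phi> N \<Phi>"
proof -
  have vertex_map: "\<phi> ` VX \<subseteq> VY" using regular by (simp add: regular_map_def)
  obtain L where edge_image: "\<And>v w. (v, w) \<in> adj SX \<Longrightarrow> \<phi> w \<in> vertex_ball SY L (\<phi> v)"
    using regular_map_adj_vertex_ball[OF complex_X complex_Y regular] by blast
  have edge: "\<forall>(v, w)\<in>adj SX. cdist VY SY (vertex_pt (\<phi> v)) (vertex_pt (\<phi> w)) \<le> ereal (2 * real L)"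
    using cdist_vertex_pt_le[OF complex_Y _ edge_image] adj_in_vertices(1)[OF complex_X] vertex_map
    by blast
  have "skeleton SX d = SX" using card_le by (auto simp: skeleton_def)
  then obtain \<Phi> T where extends: "\<And>v. \<Phi> (vertex_pt v) = vertex_pt (\<phi> v)"
    and controlled: "\<And>\<sigma>. \<sigma> \<in> SX \<Longrightarrow> controlled_on VY SY T (closed_simplex VX SX \<sigma>) \<Phi>"
    using skeleton_extension[OF complex_X complex_Y connected vertex_map edge] by metis
  obtain N :: nat where N_large: "2 + real (Suc D) * T < real N"
    using reals_Archimedean2 by blast
  have "supp (\<Phi> x) \<subseteq> vertex_ball SY N (\<phi> v)"
    if simplex: "\<sigma> \<in> SX" and v_in: "v \<in> \<sigma>" and x_in: "x \<in> closed_simplex VX SX \<sigma>" for \<sigma> v x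
  proof (rule supp_subset_vertex_ball[where x = "vertex_pt (\<phi> v)" and m = "Suc D" and t = T])
    show "card U \<le> Suc D" if "U \<in> SY" for U
      using card_simplex_le[OF complex_Y degree that] .
    show "\<Phi> x \<in> realis VY SY" using controlled[OF simplex] x_in by (auto simp: controlled_on_def)
    have "\<phi> v \<in> VY" using simplex_vertices[OF complex_X simplex] v_in vertex_map by blast
    then show "vertex_pt (\<phi> v) \<in> realis VY SY" by (rule vertex_pt_realis[OF complex_Y])
    show "cdist VY SY (vertex_pt (\<phi> v)) (\<Phi> x) \<le> ereal T"
      using controlled_on_cdist_le[OF controlled[OF simplex] _ x_in]
        vertex_pt_closed_simplex[OF complex_X simplex v_in] by (metis extends)
  qed (use complex_Y N_large in simp_all)
  with controlled have "follows_vertex_map VX SX VY SY \<phi> N \<Phi>"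
    by (simp add: follows_vertex_map_def controlled_on_def)
  then show thesis by (rule that)
qed

lemma continuous_on_push: "continuous_on A (push V g)"
proof (rule continuous_on_coordinatewise_then_product)
  fix w
  show "continuous_on A (\<lambda>f. push V g f w)"
    unfolding push_def by (cases "w \<in> g ` V") (simp_all add: continuous_on_coordinate)
qed

lemma push_closed_simplex:
  assumes complex_Z: "is_complex VZ SZ" and complex_X: "is_complex VX SX" and inj: "inj_on g VZ"
    and simplex: "\<sigma> \<in> SZ" "g ` \<sigma> \<in> SX" and f_in: "f \<in> closed_simplex VZ SZ \<sigma>"
  shows "push VZ g f \<in> closed_simplex VX SX (g ` \<sigma>)"
proof -
  have simplex_subset_VZ: "\<sigma> \<subseteq> VZ" using simplex_vertices[OF complex_Z simplex(1)] .
  have nonneg: "0 \<le> f v" and off_simplex: "v \<notin> \<sigma> \<Longrightarrow> f v = 0" and total_mass: "sum f \<sigma> = 1" for v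
    using f_in unfolding closed_simplex_eq[OF complex_Z simplex(1)] by auto
  have "push VZ g f w = 0" if "w \<notin> g ` \<sigma>" for w
  proof (cases "w \<in> g ` VZ")
    case True
    then have "inv_into VZ g w \<notin> \<sigma>" using that f_inv_into_f[OF True] by (metis imageI)
    then show ?thesis using off_simplex by (simp add: push_def)
  qed (simp add: push_def)
  moreover have "push VZ g f (g v) = f v" if "v \<in> \<sigma>" for v
    using inv_into_f_f[OF inj, of v] subsetD[OF simplex_subset_VZ that] by (simp add: push_def)
  then have "sum (push VZ g f) (g ` \<sigma>) = 1"
    using inj_on_subset[OF inj simplex_subset_VZ] total_mass by (simp add: sum.reindex)
  moreover have "0 \<le> push VZ g f w" for w
    using nonneg by (simp add: push_def)
  ultimately show ?thesis
    unfolding closed_simplex_eq[OF complex_X simplex(2)] by blast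
qed

lemma follows_vertex_map_push:
  assumes complex_Z: "is_complex VZ SZ" and complex_X: "is_complex VX SX"
    and simplicial: "inj_on g VZ" "\<And>\<sigma>. \<sigma> \<in> SZ \<Longrightarrow> g ` \<sigma> \<in> SX"
    and follows: "follows_vertex_map VX SX VY SY \<phi> N \<Phi>"
  shows "follows_vertex_map VZ SZ VY SY (\<phi> \<circ> g) N (\<Phi> \<circ> push VZ g)"
  unfolding follows_vertex_map_def
proof (intro ballI conjI)
  fix \<sigma> assume simplex: "\<sigma> \<in> SZ"
  note follows_image =
    follows[unfolded follows_vertex_map_def, rule_format, OF simplicial(2)[OF simplex]]
  have push: "push VZ g ` closed_simplex VZ SZ \<sigma> \<subseteq> closed_simplex VX SX (g ` \<sigma>)"
    using push_closed_simplex[OF complex_Z complex_X simplicial(1) simplex simplicial(2)] simplex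
    by blast
  show "continuous_on (closed_simplex VZ SZ \<sigma>) (\<Phi> \<circ> push VZ g)"
    using follows_image push
    by (intro continuous_on_compose continuous_on_push) (blast intro: continuous_on_subset)
  show "(\<Phi> \<circ> push VZ g) ` closed_simplex VZ SZ \<sigma> \<subseteq> realis VY SY"
    using follows_image push unfolding image_comp[symmetric] by (meson image_mono subset_trans)
  show "supp ((\<Phi> \<circ> push VZ g) x) \<subseteq> vertex_ball SY N ((\<phi> \<circ> g) v)"
    if "v \<in> \<sigma>" "x \<in> closed_simplex VZ SZ \<sigma>" for v x
    using follows_image subsetD[OF push imageI[OF that(2)]] that(1) by simp
qed

lemma follows_vertex_map_continuous_on:
  assumes "is_complex V S" "finite S" "follows_vertex_map V S VY SY \<psi> N \<Psi>"
  shows "continuous_on (realis V S) \<Psi>"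
  unfolding realis_eq_Union using assms closed_closed_simplex[OF assms(1)]
  by (intro continuous_on_closed_Union) (auto simp: follows_vertex_map_def)

lemma follows_vertex_map_realis:
  assumes "follows_vertex_map V S VY SY \<psi> N \<Psi>" "x \<in> realis V S"
  shows "\<Psi> x \<in> realis VY SY"
  using assms unfolding realis_eq_Union[of V S] by (auto simp: follows_vertex_map_def)

section \<open>Topological overlap\<close>

definition simplices_over ::
    "'a set \<Rightarrow> 'a set set \<Rightarrow> (('a \<Rightarrow> real) \<Rightarrow> 'c) \<Rightarrow> 'c \<Rightarrow> 'a set set" where
  "simplices_over V S f z = {\<sigma> \<in> S. z \<in> f ` closed_simplex V S \<sigma>}"

definition full_subcomplex :: "'a set set \<Rightarrow> 'a set \<Rightarrow> 'a set set" where
  "full_subcomplex S W = {U \<in> S. U \<subseteq> W}"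

lemma sOv_le_iff:
  assumes "finite S"
  shows "sOv V S f \<le> b \<longleftrightarrow> (\<forall>z. card (simplices_over V S f z) \<le> b)"
proof -
  have "sOv V S f = (SUP z. card (simplices_over V S f z))"
    by (simp add: sOv_def simplices_over_def full_SetCompr_eq)
  moreover have "bdd_above (range (\<lambda>z. card (simplices_over V S f z)))"
    using assms by (auto intro!: bdd_aboveI[of _ "card S"] card_mono simp: simplices_over_def)
  ultimately show ?thesis by (simp add: cSUP_le_iff)
qed

lemma card_simplices_over_le_sOv: "finite S \<Longrightarrow> card (simplices_over V S f z) \<le> sOv V S f"
  using sOv_le_iff[of S V f "sOv V S f"] by simp

lemma sTO_le_sOv:
  fixes f :: "('a \<Rightarrow> real) \<Rightarrow> real^'q::finite"
  assumes "continuous_on (realis V S) f"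
  shows "sTO TYPE('q) V S \<le> sOv V S f"
  unfolding sTO_def using assms by (intro cInf_lower) auto

lemma sTO_attained:
  obtains f :: "('a \<Rightarrow> real) \<Rightarrow> real^'q::finite"
  where "continuous_on (realis V S) f" "sOv V S f = sTO TYPE('q) V S"
proof -
  let ?A = "{sOv V S f | f :: ('a \<Rightarrow> real) \<Rightarrow> real^'q. continuous_on (realis V S) f}"
  have "?A \<noteq> {}" using continuous_on_const by blast
  then have "Inf ?A \<in> ?A" by (rule Inf_nat_def1)
  then show thesis using that unfolding sTO_def by auto
qed

lemma complex_subset_Pow: "is_complex V S \<Longrightarrow> S \<subseteq> Pow V"
  using simplex_vertices by blast

lemma complex_finite: "is_complex V S \<Longrightarrow> finite V \<Longrightarrow> finite S"
  by (rule finite_subset[OF complex_subset_Pow]) simp_all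

lemma sTO_le_power_card:
  assumes "is_complex V S" "finite V"
  shows "sTO TYPE('q::finite) V S \<le> 2 ^ card V"
proof -
  have finite_S: "finite S" using assms by (rule complex_finite)
  have "sTO TYPE('q) V S \<le> sOv V S (\<lambda>_. 0 :: real^'q)" by (intro sTO_le_sOv) simp
  also have "\<dots> \<le> card S"
    using finite_S by (auto simp: sOv_le_iff simplices_over_def intro: card_mono)
  also have "\<dots> \<le> card (Pow V)"
    using assms by (intro card_mono complex_subset_Pow) simp_all
  finally show ?thesis using assms(2) by (simp add: card_Pow)
qed

lemma sTO_X_le_iff:
  fixes V :: "'a set"
  shows "sTO_X TYPE('q::finite) V S r \<le> b \<longleftrightarrow>
    (\<forall>(VZ :: 'a set) SZ. is_complex VZ SZ \<and> finite VZ \<and> complex_le VZ SZ V S \<and> card VZ \<le> r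
      \<longrightarrow> sTO TYPE('q) VZ SZ \<le> b)"
proof -
  let ?A = "{sTO TYPE('q) VZ SZ | (VZ :: 'a set) SZ. is_complex VZ SZ \<and> finite VZ
       \<and> complex_le VZ SZ V S \<and> card VZ \<le> r}"
  have "is_complex ({} :: 'a set) {}" "complex_le ({} :: 'a set) {} V S"
    by (auto simp: is_complex_def complex_le_def)
  then have "?A \<noteq> {}" by fastforce
  moreover have "bdd_above ?A"
  proof (rule bdd_aboveI)
    fix n assume "n \<in> ?A"
    then obtain VZ :: "'a set" and SZ where "is_complex VZ SZ" "finite VZ" "card VZ \<le> r"
      and "n = sTO TYPE('q) VZ SZ" by blast
    then show "n \<le> 2 ^ r"
      using sTO_le_power_card[of VZ SZ] power_increasing[of "card VZ" r "2::nat"]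
      by (fastforce intro: order_trans)
  qed
  ultimately show ?thesis
    unfolding sTO_X_def by (subst cSup_le_iff) blast+
qed

lemma sTO_le_sTO_X:
  fixes V :: "'a set"
  assumes "is_complex (VZ :: 'a set) SZ" "finite VZ" "complex_le VZ SZ V S" "card VZ \<le> r"
  shows "sTO TYPE('q::finite) VZ SZ \<le> sTO_X TYPE('q) V S r"
  using sTO_X_le_iff[of V S r "sTO_X TYPE('q) V S r"] assms by blast

lemma mono_sTO_X:
  fixes V :: "'a set"
  shows "mono (sTO_X TYPE('q::finite) V S)"
proof (rule monoI)
  fix r r' :: nat assume "r \<le> r'"
  show "sTO_X TYPE('q) V S r \<le> sTO_X TYPE('q) V S r'"
    unfolding sTO_X_le_iff[of V S r]
  proof (intro allI impI, elim conjE)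
    fix VZ :: "'a set" and SZ
    assume "is_complex VZ SZ" "finite VZ" "complex_le VZ SZ V S" "card VZ \<le> r"
    then show "sTO TYPE('q) VZ SZ \<le> sTO_X TYPE('q) V S r'"
      using \<open>r \<le> r'\<close> by (intro sTO_le_sTO_X) simp_all
  qed
qed

lemma is_complex_full_subcomplex:
  assumes "is_complex V S" "W \<subseteq> V"
  shows "is_complex W (full_subcomplex S W)"
  using assms unfolding is_complex_def full_subcomplex_def by (auto 0 3)

lemma complex_le_full_subcomplex:
  assumes "W \<subseteq> V"
  shows "complex_le W (full_subcomplex S W) V S"
  unfolding complex_le_def using assms by (intro exI[of _ id]) (auto simp: full_subcomplex_def)

lemma lesssimI:
  assumes "mono g" "\<And>r. f r \<le> a * g (b * r)"
  shows "lesssim f g"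
  unfolding lesssim_def
proof (intro exI allI)
  fix r
  have "f r \<le> a * g (b * r)" by (rule assms(2))
  also have "\<dots> \<le> max a b * g (max a b * r)"
    by (intro mult_le_mono monoD[OF assms(1)]) simp_all
  finally show "f r \<le> max a b * g (max a b * r) + max a b" by simp
qed

section \<open>Comparison of overlaps along a map\<close>

definition simplices_hitting ::
    "'a set \<Rightarrow> 'a set set \<Rightarrow> (('a \<Rightarrow> real) \<Rightarrow> 'b \<Rightarrow> real) \<Rightarrow> 'b set \<Rightarrow> 'a set set" where
  "simplices_hitting V S \<Psi> \<tau> = {\<sigma> \<in> S. \<exists>x\<in>closed_simplex V S \<sigma>. supp (\<Psi> x) = \<tau>}"

definition fibres_le :: "'a set \<Rightarrow> ('a \<Rightarrow> 'b) \<Rightarrow> nat \<Rightarrow> bool" where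
  "fibres_le V \<phi> P \<longleftrightarrow> (\<forall>y. finite {x \<in> V. \<phi> x = y} \<and> card {x \<in> V. \<phi> x = y} \<le> P)"

lemma fibres_le_comp_inj:
  assumes fibres: "fibres_le V \<phi> P" and inj: "inj_on g A" "g ` A \<subseteq> V"
  shows "fibres_le A (\<phi> \<circ> g) P"
  unfolding fibres_le_def
proof (intro allI conjI)
  fix y
  have fibre: "finite {x \<in> V. \<phi> x = y}" "card {x \<in> V. \<phi> x = y} \<le> P"
    using fibres by (auto simp: fibres_le_def)
  have fibre_image: "g ` {v \<in> A. (\<phi> \<circ> g) v = y} \<subseteq> {x \<in> V. \<phi> x = y}" using inj(2) by auto
  have inj_fibre: "inj_on g {v \<in> A. (\<phi> \<circ> g) v = y}" using inj(1) by (rule inj_on_subset) auto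
  show "finite {v \<in> A. (\<phi> \<circ> g) v = y}" using inj_on_finite[OF inj_fibre fibre_image fibre(1)] .
  show "card {v \<in> A. (\<phi> \<circ> g) v = y} \<le> P"
    using card_inj_on_le[OF inj_fibre fibre_image fibre(1)] fibre(2) by (rule order_trans)
qed

lemma simplices_over_compose_subset:
  assumes "\<Psi> ` realis V S \<subseteq> realis W R"
  shows "simplices_over V S (f \<circ> \<Psi>) z \<subseteq> (\<Union>\<tau>\<in>simplices_over W R f z. simplices_hitting V S \<Psi> \<tau>)"
proof
  fix \<sigma> assume "\<sigma> \<in> simplices_over V S (f \<circ> \<Psi>) z"
  then obtain x where x_over: "\<sigma> \<in> S" "x \<in> closed_simplex V S \<sigma>" "z = f (\<Psi> x)"
    by (auto simp: simplices_over_def)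
  then have "\<Psi> x \<in> realis W R" using assms closed_simplex_realis by blast
  then have "supp (\<Psi> x) \<in> simplices_over W R f z"
    using x_over(3) realis_supp realis_in_closed_simplex_supp
    by (fastforce simp: simplices_over_def)
  moreover have "\<sigma> \<in> simplices_hitting V S \<Psi> (supp (\<Psi> x))"
    using x_over by (auto simp: simplices_hitting_def)
  ultimately show "\<sigma> \<in> (\<Union>\<tau>\<in>simplices_over W R f z. simplices_hitting V S \<Psi> \<tau>)" by blast
qed

lemma sTO_le_mult_sTO:
  fixes \<Psi> :: "('a \<Rightarrow> real) \<Rightarrow> ('b \<Rightarrow> real)"
  assumes "finite S" "finite R"
    and cont: "continuous_on (realis V S) \<Psi>" and image: "\<Psi> ` realis V S \<subseteq> realis W R"
    and card_hitting: "\<And>\<tau>. \<tau> \<in> R \<Longrightarrow> card (simplices_hitting V S \<Psi> \<tau>) \<le> M"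
  shows "sTO TYPE('q::finite) V S \<le> M * sTO TYPE('q) W R"
proof -
  obtain f :: "('b \<Rightarrow> real) \<Rightarrow> real^'q"
    where cont_f: "continuous_on (realis W R) f" and optimal: "sOv W R f = sTO TYPE('q) W R"
    by (rule sTO_attained)
  have "continuous_on (realis V S) (f \<circ> \<Psi>)"
    using cont by (rule continuous_on_compose) (rule continuous_on_subset[OF cont_f image])
  then have "sTO TYPE('q) V S \<le> sOv V S (f \<circ> \<Psi>)" by (rule sTO_le_sOv)
  also have "\<dots> \<le> M * sOv W R f"
    unfolding sOv_le_iff[OF \<open>finite S\<close>]
  proof
    fix z
    let ?T = "simplices_over W R f z"
    have over: "finite ?T" "?T \<subseteq> R" using \<open>finite R\<close> by (auto simp: simplices_over_def)
    have "card (simplices_over V S (f \<circ> \<Psi>) z) \<le> card (\<Union>\<tau>\<in>?T. simplices_hitting V S \<Psi> \<tau>)"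
      using over(1) \<open>finite S\<close>
      by (intro card_mono simplices_over_compose_subset[OF image] finite_UN_I)
        (simp_all add: simplices_hitting_def)
    also have "\<dots> \<le> card ?T * M"
      using over card_hitting by (intro card_UN_le_mult) auto
    also have "\<dots> \<le> M * sOv W R f"
      using card_simplices_over_le_sOv[OF \<open>finite R\<close>, of W f z] by (simp add: mult.commute)
    finally show "card (simplices_over V S (f \<circ> \<Psi>) z) \<le> M * sOv W R f" .
  qed
  finally show ?thesis using optimal by simp
qed

lemma card_Collect_fibres_le:
  assumes "fibres_le V \<psi> P" "finite B"
  shows "finite {v \<in> V. \<psi> v \<in> B}" "card {v \<in> V. \<psi> v \<in> B} \<le> card B * P"
proof -
  have fibres: "{v \<in> V. \<psi> v \<in> B} = (\<Union>y\<in>B. {v \<in> V. \<psi> v = y})" by blast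
  show "finite {v \<in> V. \<psi> v \<in> B}"
    unfolding fibres using assms by (simp add: fibres_le_def)
  show "card {v \<in> V. \<psi> v \<in> B} \<le> card B * P"
    unfolding fibres using assms by (intro card_UN_le_mult) (simp_all add: fibres_le_def)
qed

lemma simplices_hitting_subset_Pow:
  assumes complex: "is_complex V S" and follows: "follows_vertex_map V S VY SY \<psi> N \<Psi>" and "u \<in> \<tau>"
  shows "simplices_hitting V S \<Psi> \<tau> \<subseteq> Pow {v \<in> V. \<psi> v \<in> vertex_ball SY N u}"
proof (intro subsetI PowI)
  fix \<sigma> v assume "\<sigma> \<in> simplices_hitting V S \<Psi> \<tau>" and "v \<in> \<sigma>"
  then obtain x where x_hits: "\<sigma> \<in> S" "x \<in> closed_simplex V S \<sigma>" "supp (\<Psi> x) = \<tau>"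
    by (auto simp: simplices_hitting_def)
  then have "u \<in> vertex_ball SY N (\<psi> v)"
    using follows \<open>u \<in> \<tau>\<close> \<open>v \<in> \<sigma>\<close> unfolding follows_vertex_map_def by blast
  then show "v \<in> {v \<in> V. \<psi> v \<in> vertex_ball SY N u}"
    using vertex_ball_sym simplex_vertices[OF complex x_hits(1)] \<open>v \<in> \<sigma>\<close> by fastforce
qed

lemma card_simplices_hitting_le:
  assumes complex: "is_complex V S" and complex_Y: "is_complex VY SY"
    and degree: "degree_le VY SY D"
    and follows: "follows_vertex_map V S VY SY \<psi> N \<Psi>" and fibres: "fibres_le V \<psi> P"
    and "\<tau> \<in> SY"
  shows "card (simplices_hitting V S \<Psi> \<tau>) \<le> 2 ^ (Suc D ^ N * P)"
proof (cases "\<tau> = {}")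
  case True
  have "supp (\<Psi> x) \<noteq> {}" if "x \<in> realis V S" for x
    using realis_supp_nonempty[OF follows_vertex_map_realis[OF follows that]] .
  then have "simplices_hitting V S \<Psi> \<tau> = {}"
    using True by (auto simp: simplices_hitting_def dest: closed_simplex_realis)
  then show ?thesis by simp
next
  case False
  then obtain u where "u \<in> \<tau>" by blast
  then have "u \<in> VY" using simplex_vertices[OF complex_Y \<open>\<tau> \<in> SY\<close>] by blast
  note ball = card_vertex_ball[OF complex_Y degree this, of N]
  let ?K = "{v \<in> V. \<psi> v \<in> vertex_ball SY N u}"
  note near = card_Collect_fibres_le[OF fibres ball(1)]
  have "card ?K \<le> Suc D ^ N * P"
    using near(2) mult_le_mono1[OF ball(2), of P] by (rule order_trans)
  then have "card (Pow ?K) \<le> 2 ^ (Suc D ^ N * P)"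
    by (simp add: card_Pow near(1) power_increasing)
  moreover have "card (simplices_hitting V S \<Psi> \<tau>) \<le> card (Pow ?K)"
    using near(1) by (intro card_mono simplices_hitting_subset_Pow[OF complex follows \<open>u \<in> \<tau>\<close>]) simp
  ultimately show ?thesis by simp
qed

lemma follows_vertex_map_in_full_subcomplex:
  assumes complex: "is_complex V S" and follows: "follows_vertex_map V S VY SY \<psi> N \<Psi>"
    and x_in: "x \<in> realis V S" and balls: "\<And>v. v \<in> V \<Longrightarrow> vertex_ball SY N (\<psi> v) \<subseteq> W"
  shows "\<Psi> x \<in> realis W (full_subcomplex SY W)"
proof -
  obtain v where v_in: "v \<in> supp x" using realis_supp_nonempty[OF x_in] by blast
  then have "v \<in> V" using simplex_vertices[OF complex realis_supp[OF x_in]] by blast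
  moreover have "supp (\<Psi> x) \<subseteq> vertex_ball SY N (\<psi> v)"
    using follows v_in realis_supp[OF x_in] realis_in_closed_simplex_supp[OF x_in]
    unfolding follows_vertex_map_def by blast
  ultimately have "supp (\<Psi> x) \<subseteq> W" using balls by blast
  then show ?thesis
    using follows_vertex_map_realis[OF follows x_in] by (simp add: realis_def full_subcomplex_def)
qed

lemma follows_vertex_map_imp_sTO_le:
  assumes complex_Z: "is_complex V S" "finite V"
    and complex_Y: "is_complex VY SY" and degree: "degree_le VY SY D"
    and vertex_map: "\<psi> ` V \<subseteq> VY" and fibres: "fibres_le V \<psi> P"
    and follows: "follows_vertex_map V S VY SY \<psi> N \<Psi>"
  shows "sTO TYPE('q::finite) V S
    \<le> 2 ^ (Suc D ^ N * P) * sTO_X TYPE('q) VY SY (Suc D ^ N * card V)"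
proof -
  define W where "W = (\<Union>v\<in>V. vertex_ball SY N (\<psi> v))"
  have image_in_VY: "\<psi> v \<in> VY" if "v \<in> V" for v using vertex_map that by blast
  note ball = card_vertex_ball[OF complex_Y degree image_in_VY, of _ N]
  have finite_W: "finite W"
    unfolding W_def using complex_Z(2) ball(1) by blast
  have W_subset: "W \<subseteq> VY"
    unfolding W_def using vertex_ball_subset[OF complex_Y image_in_VY] by blast
  have "card W \<le> card V * Suc D ^ N"
    unfolding W_def using complex_Z(2) ball(2) by (rule card_UN_le_mult)
  then have card_W: "card W \<le> Suc D ^ N * card V" by (simp add: mult.commute)
  note complex_W = is_complex_full_subcomplex[OF complex_Y W_subset]
  have "vertex_ball SY N (\<psi> v) \<subseteq> W" if "v \<in> V" for v
    unfolding W_def using that by blast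
  then have "\<Psi> ` realis V S \<subseteq> realis W (full_subcomplex SY W)"
    using follows_vertex_map_in_full_subcomplex[OF complex_Z(1) follows] by blast
  moreover have "card (simplices_hitting V S \<Psi> \<tau>) \<le> 2 ^ (Suc D ^ N * P)"
    if "\<tau> \<in> full_subcomplex SY W" for \<tau>
    using card_simplices_hitting_le[OF complex_Z(1) complex_Y degree follows fibres] that
    by (simp add: full_subcomplex_def)
  ultimately have "sTO TYPE('q) V S \<le> 2 ^ (Suc D ^ N * P) * sTO TYPE('q) W (full_subcomplex SY W)"
    using complex_finite[OF complex_Z] complex_finite[OF complex_W finite_W]
      follows_vertex_map_continuous_on[OF complex_Z(1) complex_finite[OF complex_Z] follows]
    by (intro sTO_le_mult_sTO)
  also have "\<dots> \<le> 2 ^ (Suc D ^ N * P) * sTO_X TYPE('q) VY SY (Suc D ^ N * card V)"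
    by (intro mult_le_mono2 sTO_le_sTO_X complex_W finite_W complex_le_full_subcomplex W_subset
        card_W)
  finally show ?thesis .
qed

lemma follows_vertex_map_imp_sTO_X_le:
  fixes VX :: "'a set"
  assumes complex_X: "is_complex VX SX" and complex_Y: "is_complex VY SY"
    and degree: "degree_le VY SY D"
    and vertex_map: "\<phi> ` VX \<subseteq> VY" and fibres: "fibres_le VX \<phi> P"
    and follows: "follows_vertex_map VX SX VY SY \<phi> N \<Phi>"
  shows "sTO_X TYPE('q::finite) VX SX r
    \<le> 2 ^ (Suc D ^ N * P) * sTO_X TYPE('q) VY SY (Suc D ^ N * r)"
  unfolding sTO_X_le_iff
proof (intro allI impI, elim conjE)
  fix VZ :: "'a set" and SZ
  assume complex_Z: "is_complex VZ SZ" "finite VZ"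
    and subcomplex: "complex_le VZ SZ VX SX" and card_le: "card VZ \<le> r"
  obtain g where embedding: "inj_on g VZ" "g ` VZ \<subseteq> VX" "\<And>\<sigma>. \<sigma> \<in> SZ \<Longrightarrow> g ` \<sigma> \<in> SX"
    using subcomplex unfolding complex_le_def by blast
  have "(\<phi> \<circ> g) ` VZ \<subseteq> VY" using embedding(2) vertex_map by auto
  then have "sTO TYPE('q) VZ SZ
      \<le> 2 ^ (Suc D ^ N * P) * sTO_X TYPE('q) VY SY (Suc D ^ N * card VZ)"
    using fibres_le_comp_inj[OF fibres embedding(1,2)]
      follows_vertex_map_push[OF complex_Z(1) complex_X embedding(1,3) follows]
    by (rule follows_vertex_map_imp_sTO_le[OF complex_Z complex_Y degree])
  also have "\<dots> \<le> 2 ^ (Suc D ^ N * P) * sTO_X TYPE('q) VY SY (Suc D ^ N * r)"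
    using card_le by (intro mult_le_mono2 monoD[OF mono_sTO_X]) simp
  finally show "sTO TYPE('q) VZ SZ \<le> 2 ^ (Suc D ^ N * P) * sTO_X TYPE('q) VY SY (Suc D ^ N * r)" .
qed

theorem theorem1p2:
  fixes VX :: "'a set" and SX :: "'a set set" and VY :: "'b set" and SY :: "'b set set"
    and d :: nat and \<phi> :: "'a \<Rightarrow> 'b"
  assumes "bounded_degree VX SX" and "bounded_degree VY SY"
    and "has_dim SX d"
    and "\<forall>k. 1 \<le> k \<and> k \<le> d \<longrightarrow> unif_connected VY SY k"
    and "regular_map VX SX VY SY \<phi>"
  shows "lesssim (sTO_X (TYPE('q::finite)) VX SX) (sTO_X (TYPE('q)) VY SY)"
proof -
  have complex_X: "is_complex VX SX" and complex_Y: "is_complex VY SY"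
    using assms(1,2) by (simp_all add: bounded_degree_def)
  obtain D where degree: "degree_le VY SY D"
    using assms(2) unfolding bounded_degree_def degree_le_def by blast
  obtain P where vertex_map: "\<phi> ` VX \<subseteq> VY" and fibres: "fibres_le VX \<phi> P"
    using assms(5) unfolding regular_map_def fibres_le_def by blast
  have card_le: "\<And>\<sigma>. \<sigma> \<in> SX \<Longrightarrow> card \<sigma> \<le> Suc d"
    using assms(3) by (simp add: has_dim_def)
  obtain \<Phi> N where "follows_vertex_map VX SX VY SY \<phi> N \<Phi>"
    using regular_map_extension[OF complex_X complex_Y degree card_le assms(4,5)] by blast
  then have "sTO_X TYPE('q) VX SX r
      \<le> 2 ^ (Suc D ^ N * P) * sTO_X TYPE('q) VY SY (Suc D ^ N * r)" for r
    by (rule follows_vertex_map_imp_sTO_X_le[OF complex_X complex_Y degree vertex_map fibres])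
  then show ?thesis
    by (rule lesssimI[OF mono_sTO_X])
qed

end
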